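(* Let $G$ be a connected unicyclic graph with cycle of size $c\ge3$ and with $r\ge2$ non-trivial rooted trees attached to the cycle. Let $s$ be the number of sprouts of $G$ and let $b_1,\dots,b_s$ be their degrees; let $p$ be the number of non-sprout deep vertices of $G$ and let $d_1,\dots,d_p$ be their degrees (all degrees taken in $G$). Then the leading coefficient of $\mathbf{X}_G$ is \[c_{\lambda_{\mathrm{lead}}}=(-1)^{p+s}\begin{cases} \displaystyle\prod_{i=1}^p(d_i-1)\left[\left(\prod_{i=1}^s(b_i-1)\right)-\sum_{i=1}^s b_i+2s-1\right] & \text{if } r=s,\\[3mm] \displaystyle\prod_{i=1}^p(d_i-1)\left[\left(\prod_{i=1}^s(b_i-1)\right)-1\right] & \text{if } r=s+1,\\[3mm] \displaystyle\prod_{i=1}^p(d_i-1)\prod_{i=1}^s(b_i-1) & \text{if } r\ge s+2. \end{cases}\]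
   Context: All graphs are finite and simple. The chromatic symmetric function of a graph $G$ with vertices $v_1,\dots,v_n$ is $\mathbf{X}_G=\sum_\kappa x_{\kappa(v_1)}\cdots x_{\kappa(v_n)}$, summed over all proper colorings $\kappa:V(G)\to\mathbb{N}$. The star graph $\mathsf{St}_k$ on $k$ vertices is the tree with one central vertex adjacent to $k-1$ leaves ($\mathsf{St}_1$ is a single vertex); $\mathfrak{st}_k:=\mathbf{X}_{\mathsf{St}_k}$, and for a partition $\lambda=(\lambda_1,\dots,\lambda_\ell)$, $\mathfrak{st}_\lambda:=\mathfrak{st}_{\lambda_1}\cdots\mathfrak{st}_{\lambda_\ell}$. The set $\{\mathfrak{st}_\lambda:\lambda\vdash n\}$ is a $\mathbb{Q}$-basis (the star-basis) of the space of homogeneous symmetric functions of degree $n$, so $\mathbf{X}_G=\sum_{\lambda\vdash n}c_\lambda\mathfrak{st}_\lambda$ with uniquely determined coefficients $c_\lambda$. Partitions of $n$ are ordered lexicographically: $\mu\le\lambda$ if $\mu=\lambda$ or, for some $j$, $\mu_i=\lambda_i$ for $i<j$ and $\mu_j<\lambda_j$. The leading partition $\lambda_{\mathrm{lead}}$ is the smallest partition $\lambda$ in lexicographic order with $c_\lambda\ne0$, and $c_{\lambda_{\mathrm{lead}}}$ is the leading coefficient. A unicyclic graph is a graph containing exactly one cycle. If $G$ is connected unicyclic with cycle vertices $v_1,\dots,v_c$, then deleting the edges of the cycle leaves $c$ trees $T_1,\dots,T_c$ with $T_i$ containing (and rooted at) $v_i$; $T_i$ is non-trivial if it has more than one vertex.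 A leaf is a vertex of degree one; an internal vertex is a vertex of degree at least two; a deep vertex is an internal vertex with no adjacent leaves. A sprout is a deep vertex that lies on the cycle and has degree at least three. Non-sprout deep vertices are all the other deep vertices of $G$ (including deep cycle vertices of degree two). Empty products equal $1$. *)

theory Defs
  imports Complex_Main "HOL-Library.Multiset" "HOL-Library.FuncSet" "HOL-Library.List_Lexorder"
begin

section \<open>Formal power series in countably many variables\<close>

text \<open>A monomial $x_{i_1} \cdots x_{i_n}$ is represented by the multiset of the indices of its
  variables, so that multiplication of monomials is addition of multisets.\<close>

typedef 'a mfps = "UNIV :: (nat multiset \<Rightarrow> 'a) set"
  morphisms mfps_coeff Abs_mfps
  by simp

lemma mfps_coeff_Abs [simp]: "mfps_coeff (Abs_mfps f) = f"
  by (simp add: Abs_mfps_inverse)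

lemma mfps_eqI: "(\<And>M. mfps_coeff f M = mfps_coeff g M) \<Longrightarrow> f = g"
  by (metis ext mfps_coeff_inject)

lemma finite_mset_splits [simp]: "finite {(A, B). A + B = (M :: 'b multiset)}"
proof -
  have "finite {A. A \<subseteq># M}"
  proof (induction M)
    case empty
    then show ?case by simp
  next
    case (add x M)
    have "A \<in> {A. A \<subseteq># M} \<union> add_mset x ` {A. A \<subseteq># M}" if "A \<subseteq># add_mset x M" for A
    proof (cases "x \<in># A")
      case True
      then obtain B where "A = add_mset x B" by (meson multi_member_split)
      with that show ?thesis by auto
    next
      case False
      then have "A \<subseteq># M"
        using that by (metis diff_single_trivial diff_subset_eq_self subset_eq_diff_conv
            add_mset_add_single)
      then show ?thesis by simp
    qed
    then have "{A. A \<subseteq># add_mset x M} \<subseteq> {A. A \<subseteq># M} \<union> add_mset x ` {A. A \<subseteq># M}" by blast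
    then show ?case using add by (meson finite_UnI finite_imageI finite_subset)
  qed
  then have "finite ((\<lambda>A. (A, M - A)) ` {A. A \<subseteq># M})" by (rule finite_imageI)
  moreover have "{(A, B). A + B = M} \<subseteq> (\<lambda>A. (A, M - A)) ` {A. A \<subseteq># M}" by force
  ultimately show ?thesis by (rule finite_subset[rotated])
qed

instantiation mfps :: (comm_ring_1) comm_ring_1
begin

definition "0 = Abs_mfps (\<lambda>_. 0)"
definition "1 = Abs_mfps (\<lambda>M. if M = {#} then 1 else 0)"
definition "f + g = Abs_mfps (\<lambda>M. mfps_coeff f M + mfps_coeff g M)"
definition "f - g = Abs_mfps (\<lambda>M. mfps_coeff f M - mfps_coeff g M)"
definition "- f = Abs_mfps (\<lambda>M. - mfps_coeff f M)"
definition "f * g = Abs_mfps (\<lambda>M. \<Sum>(A, B) | A + B = M. mfps_coeff f A * mfps_coeff g B)"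

instance
proof
  fix f g h :: "'a mfps"
  let ?c = mfps_coeff
  show "f * g * h = f * (g * h)"
  proof (rule mfps_eqI)
    fix M
    let ?P = "\<lambda>M :: nat multiset. {(A, B). A + B = M}"
    have "?c (f * g * h) M =
        (\<Sum>(D, C)\<in>?P M. \<Sum>(A, B)\<in>?P D. ?c f A * ?c g B * ?c h C)"
      by (simp add: times_mfps_def sum_distrib_right case_prod_beta)
    also have "\<dots> = (\<Sum>((D, C), (A, B))\<in>Sigma (?P M) (\<lambda>(D, C). ?P D). ?c f A * ?c g B * ?c h C)"
      by (subst sum.Sigma[symmetric]) (auto simp: case_prod_beta)
    also have "\<dots> = (\<Sum>((A, D), (B, C))\<in>Sigma (?P M) (\<lambda>(A, D). ?P D). ?c f A * ?c g B * ?c h C)"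
      by (rule sum.reindex_bij_witness[of _
            "\<lambda>((A, D), (B, C)). ((A + B, C), (A, B))" "\<lambda>((D, C), (A, B)). ((A, B + C), (B, C))"])
         (auto simp: add.assoc)
    also have "\<dots> = (\<Sum>(A, D)\<in>?P M. \<Sum>(B, C)\<in>?P D. ?c f A * ?c g B * ?c h C)"
      by (subst sum.Sigma[symmetric]) (auto simp: case_prod_beta)
    also have "\<dots> = ?c (f * (g * h)) M"
      by (simp add: times_mfps_def sum_distrib_left case_prod_beta mult.assoc)
    finally show "?c (f * g * h) M = ?c (f * (g * h)) M" .
  qed
  show "f * g = g * f"
  proof (rule mfps_eqI)
    fix M
    show "?c (f * g) M = ?c (g * f) M"
      unfolding times_mfps_def mfps_coeff_Abs
      by (rule sum.reindex_bij_witness[of _ "\<lambda>(A, B). (B, A)" "\<lambda>(A, B). (B, A)"])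
         (auto simp: add.commute mult.commute)
  qed
  show "1 * f = f"
  proof (rule mfps_eqI)
    fix M
    have "?c (1 * f) M = (\<Sum>(A, B) | A + B = M. ?c 1 A * ?c f B)"
      by (simp add: times_mfps_def)
    also have "\<dots> = (\<Sum>(A, B)\<in>{({#}, M)}. ?c 1 A * ?c f B)"
      by (rule sum.mono_neutral_right) (auto simp: one_mfps_def split: if_splits)
    finally show "?c (1 * f) M = ?c f M" by (simp add: one_mfps_def)
  qed
  show "(f + g) * h = f * h + g * h"
    by (rule mfps_eqI)
       (simp add: times_mfps_def plus_mfps_def case_prod_beta distrib_right sum.distrib)
  show "(0 :: 'a mfps) \<noteq> 1"
  proof
    assume "(0 :: 'a mfps) = 1"
    then have "?c (0 :: 'a mfps) {#} = ?c 1 {#}" by simp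
    then show False by (simp add: zero_mfps_def one_mfps_def)
  qed
qed (auto intro!: mfps_eqI
      simp: plus_mfps_def minus_mfps_def uminus_mfps_def zero_mfps_def add_ac)

end

definition mfps_scale :: "'a::comm_ring_1 \<Rightarrow> 'a mfps \<Rightarrow> 'a mfps" where
  "mfps_scale c f = Abs_mfps (\<lambda>M. c * mfps_coeff f M)"

section \<open>Graphs\<close>

definition simple_graph :: "'a set \<Rightarrow> 'a set set \<Rightarrow> bool" where
  "simple_graph V E \<longleftrightarrow> finite V \<and> (\<forall>e\<in>E. e \<subseteq> V \<and> card e = 2)"

definition adj_rel :: "'a set set \<Rightarrow> 'a rel" where
  "adj_rel E = {(u, v). {u, v} \<in> E}"

definition connected_graph :: "'a set \<Rightarrow> 'a set set \<Rightarrow> bool" where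
  "connected_graph V E \<longleftrightarrow> V \<noteq> {} \<and> (\<forall>u\<in>V. \<forall>v\<in>V. (u, v) \<in> (adj_rel E)\<^sup>*)"

definition vdegree :: "'a set set \<Rightarrow> 'a \<Rightarrow> nat" where
  "vdegree E v = card {e \<in> E. v \<in> e}"

text \<open>A cycle, as a subgraph, is identified with its set of edges; different vertex sequences
  (rotations, reversals) may describe the same cycle.\<close>

definition cycle_edges :: "'a list \<Rightarrow> 'a set set" where
  "cycle_edges vs = {{vs ! i, vs ! (Suc i mod length vs)} | i. i < length vs}"

definition cycles :: "'a set set \<Rightarrow> 'a set set set" where
  "cycles E = {cycle_edges vs | vs. length vs \<ge> 3 \<and> distinct vs \<and> cycle_edges vs \<subseteq> E}"

definition unicyclic :: "'a set set \<Rightarrow> bool" where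
  "unicyclic E \<longleftrightarrow> (\<exists>!C. C \<in> cycles E)"

text \<open>In the following, \<open>C\<close> is the edge set of the cycle, so \<open>\<Union>C\<close> is the set of its vertices.\<close>

definition attached_tree :: "'a set \<Rightarrow> 'a set set \<Rightarrow> 'a set set \<Rightarrow> 'a \<Rightarrow> 'a set" where
  "attached_tree V E C v = {u \<in> V. (v, u) \<in> (adj_rel (E - C))\<^sup>*}"

definition nontrivial_roots :: "'a set \<Rightarrow> 'a set set \<Rightarrow> 'a set set \<Rightarrow> 'a set" where
  "nontrivial_roots V E C = {v \<in> \<Union>C. card (attached_tree V E C v) > 1}"

definition leaves :: "'a set \<Rightarrow> 'a set set \<Rightarrow> 'a set" where
  "leaves V E = {v \<in> V. vdegree E v = 1}"

definition internal_vertices :: "'a set \<Rightarrow> 'a set set \<Rightarrow> 'a set" where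
  "internal_vertices V E = {v \<in> V. vdegree E v \<ge> 2}"

definition deep_vertices :: "'a set \<Rightarrow> 'a set set \<Rightarrow> 'a set" where
  "deep_vertices V E = {v \<in> internal_vertices V E. \<forall>u\<in>leaves V E. {u, v} \<notin> E}"

definition sprouts :: "'a set \<Rightarrow> 'a set set \<Rightarrow> 'a set set \<Rightarrow> 'a set" where
  "sprouts V E C = {v \<in> deep_vertices V E. v \<in> \<Union>C \<and> vdegree E v \<ge> 3}"

section \<open>Chromatic symmetric functions and the star basis\<close>

definition proper_colorings :: "'a set \<Rightarrow> 'a set set \<Rightarrow> ('a \<Rightarrow> nat) set" where
  "proper_colorings V E = {\<kappa> \<in> V \<rightarrow>\<^sub>E UNIV. \<forall>u v. {u, v} \<in> E \<longrightarrow> \<kappa> u \<noteq> \<kappa> v}"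

text \<open>The coefficient of a monomial counts the proper colorings contributing that monomial;
  there are finitely many of them for each monomial.\<close>

definition chromatic_sf :: "'a set \<Rightarrow> 'a set set \<Rightarrow> rat mfps" where
  "chromatic_sf V E = Abs_mfps (\<lambda>M.
     of_nat (card {\<kappa> \<in> proper_colorings V E. image_mset \<kappa> (mset_set V) = M}))"

definition star_sf :: "nat \<Rightarrow> rat mfps" where
  "star_sf k = chromatic_sf {0..<k} {{0, i} | i. i \<in> {1..<k}}"

definition partitions :: "nat \<Rightarrow> nat list set" where
  "partitions n = {\<mu>. sorted_wrt (\<ge>) \<mu> \<and> (\<forall>i\<in>set \<mu>. i > 0) \<and> sum_list \<mu> = n}"

lemma finite_partitions: "finite (partitions n)"
proof (rule finite_subset)
  show "partitions n \<subseteq> {xs. set xs \<subseteq> {..n} \<and> length xs \<le> n}"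
  proof
    fix xs
    assume xs: "xs \<in> partitions n"
    have "length ys \<le> sum_list ys" if "\<forall>i\<in>set ys. i > 0" for ys :: "nat list"
      using that by (induction ys) auto
    with xs show "xs \<in> {xs. set xs \<subseteq> {..n} \<and> length xs \<le> n}"
      using member_le_sum_list by (fastforce simp: partitions_def)
  qed
  show "finite {xs. set xs \<subseteq> {..n} \<and> length xs \<le> n}"
    by (rule finite_lists_length_le) simp
qed

definition star_part_sf :: "nat list \<Rightarrow> rat mfps" where
  "star_part_sf \<mu> = prod_list (map star_sf \<mu>)"

definition star_coeff :: "'a set \<Rightarrow> 'a set set \<Rightarrow> nat list \<Rightarrow> rat" where
  "star_coeff V E = (THE c. (\<forall>\<mu>. \<mu> \<notin> partitions (card V) \<longrightarrow> c \<mu> = 0) \<and>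
     chromatic_sf V E = (\<Sum>\<mu>\<in>partitions (card V). mfps_scale (c \<mu>) (star_part_sf \<mu>)))"

text \<open>\<open>Min\<close> refers to the lexicographic order on lists from \<open>HOL-Library.List_Lexorder\<close>. No partition
  of \<open>n\<close> is a proper prefix of another one, so only the first differing part matters.\<close>

definition leading_partition :: "'a set \<Rightarrow> 'a set set \<Rightarrow> nat list" where
  "leading_partition V E = Min {\<mu> \<in> partitions (card V). star_coeff V E \<mu> \<noteq> 0}"

definition leading_coeff :: "'a set \<Rightarrow> 'a set set \<Rightarrow> rat" where
  "leading_coeff V E = star_coeff V E (leading_partition V E)"

end

(* Colour the internal vertices first and expand over the edges joining them: the chromatic
   symmetric function becomes a signed sum, over sets S of such edges, of products over the components
   B of S of sum_i x_i^a (p_1 - x_i)^b, where a = |B| and b is the number of leaves attached to B.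
   The smallest star product in such a factor has parts b + 1, 1, ..., 1.  Hence nothing below the
   partition with the parts 1 + (number of leaves at v), for v internal, occurs, and the coefficient of
   that partition is the signed number of edge sets S no component of which contains two vertices with
   leaves.

   This number is computed with vertex weights f_v + m_v eps in the dual numbers, a component having
   weight f + m if the product of its vertex weights is f + m eps.  Deleting a pendant vertex u at v
   gives the factor m_u and changes m_v to m_v - f_v, which reduces the graph to its cycle; the cycle is
   opened at one edge, the error coming only from the edge set that spans the whole cycle.

   The star coefficients are unique because products of power sums are linearly independent and
   expand into equally many star products. *)

theory Submission
  imports Defs "HOL-Library.Multiset_Order"
begin

section \<open>Generating functions of colorings\<close>

text \<open>Edges to leaves stay out of the expansion because a single internal vertex with its
  leaves is then already a star; only merged internal vertices give more than one star product, and
  the extra terms have a larger greatest part. "At most one vertex with leaves per component" is not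
  multiplicative over the vertices, but becomes so in the dual numbers. The weights must be
  arbitrary ring elements since removing a pendant vertex takes \<open>m\<close> out of the values 0
  and 1: every removed edge at v subtracts \<open>f v\<close> once, and these subtractions
  accumulate to the factors d - 1. The extra term of the cycle involves only the product of weights
  along the cycle, so it vanishes as soon as two cycle vertices carry leaves. As r - s counts the
  cycle vertices with leaves, this is the origin of the three cases. A coefficient below which
  nothing occurs is the leading one only if it is nonzero: for r \<le> 1 the bracket is 0, and r
  \<ge> 2 is what makes the candidate partition the leading one.\<close>

definition colorings_of_type :: "'a set \<Rightarrow> nat multiset \<Rightarrow> ('a \<Rightarrow> nat) set" where
  "colorings_of_type V M = {\<kappa> \<in> V \<rightarrow>\<^sub>E UNIV. image_mset \<kappa> (mset_set V) = M}"

text \<open>Weights in place of conditions: indicators of conditions on a coloring can be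
  subtracted, multiplied and summed with signs, which inclusion-exclusion needs.\<close>

definition coloring_gf :: "'a set \<Rightarrow> (('a \<Rightarrow> nat) \<Rightarrow> rat) \<Rightarrow> rat mfps" where
  "coloring_gf V w = Abs_mfps (\<lambda>M. \<Sum>\<kappa>\<in>colorings_of_type V M. w \<kappa>)"

lemma finite_colorings_of_type: "finite V \<Longrightarrow> finite (colorings_of_type V M)"
proof -
  assume V: "finite V"
  have "colorings_of_type V M \<subseteq> V \<rightarrow>\<^sub>E set_mset M"
    using V by (auto simp: colorings_of_type_def PiE_def)
  then show ?thesis using V by (meson finite_PiE finite_set_mset finite_subset)
qed

lemma chromatic_sf_eq_gf:
  assumes "finite V"
  shows "chromatic_sf V E = coloring_gf V (\<lambda>\<kappa>. of_bool (\<forall>u v. {u, v} \<in> E \<longrightarrow> \<kappa> u \<noteq> \<kappa> v))"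
proof (rule mfps_eqI)
  fix M
  have "{\<kappa> \<in> proper_colorings V E. image_mset \<kappa> (mset_set V) = M} =
     colorings_of_type V M \<inter> {\<kappa>. \<forall>u v. {u, v} \<in> E \<longrightarrow> \<kappa> u \<noteq> \<kappa> v}"
    by (auto simp: proper_colorings_def colorings_of_type_def)
  then show "mfps_coeff (chromatic_sf V E) M =
     mfps_coeff (coloring_gf V (\<lambda>\<kappa>. of_bool (\<forall>u v. {u, v} \<in> E \<longrightarrow> \<kappa> u \<noteq> \<kappa> v))) M"
    by (simp add: chromatic_sf_def coloring_gf_def finite_colorings_of_type[OF assms] of_bool_def sum.If_cases)
qed

lemma coloring_gf_cong:
  "(\<And>\<kappa>. \<kappa> \<in> V \<rightarrow>\<^sub>E UNIV \<Longrightarrow> f \<kappa> = g \<kappa>) \<Longrightarrow> coloring_gf V f = coloring_gf V g"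
  unfolding coloring_gf_def by (intro arg_cong[where f = Abs_mfps] ext sum.cong) (auto simp: colorings_of_type_def)

lemma coloring_gf_diff: "coloring_gf V (\<lambda>\<kappa>. f \<kappa> - g \<kappa>) = coloring_gf V f - coloring_gf V g"
  by (rule mfps_eqI) (simp add: coloring_gf_def minus_mfps_def sum_subtractf)

lemma mfps_coeff_add: "mfps_coeff (f + g) M = mfps_coeff f M + mfps_coeff g M"
  by (simp add: plus_mfps_def)

lemma mfps_coeff_0: "mfps_coeff 0 M = 0"
  by (simp add: zero_mfps_def)

lemma mfps_coeff_sum: "mfps_coeff (\<Sum>i\<in>A. f i) M = (\<Sum>i\<in>A. mfps_coeff (f i) M)"
  by (induction A rule: infinite_finite_induct) (simp_all add: mfps_coeff_add mfps_coeff_0)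

lemma mfps_coeff_mult: "mfps_coeff (f * g) M = (\<Sum>(A, B) | A + B = M. mfps_coeff f A * mfps_coeff g B)"
  by (simp add: times_mfps_def)

lemma coloring_gf_sign_sum:
  "coloring_gf V (\<lambda>\<kappa>. \<Sum>i\<in>A. (-1) ^ k i * f i \<kappa>) = (\<Sum>i\<in>A. (-1) ^ k i * coloring_gf V (f i))"
proof -
  have neg: "mfps_coeff ((-1) ^ j * g) M = (-1) ^ j * mfps_coeff g M" for j and g :: "rat mfps" and M
  proof (induction j)
    case (Suc j)
    have "(-1) ^ Suc j * g = - ((-1) ^ j * g)" by simp
    then have "mfps_coeff ((-1) ^ Suc j * g) M = - mfps_coeff ((-1) ^ j * g) M"
      by (simp only: uminus_mfps_def mfps_coeff_Abs)
    with Suc show ?case by simp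
  qed simp
  show ?thesis
    by (rule mfps_eqI)
       (simp add: mfps_coeff_sum neg coloring_gf_def sum_distrib_left, rule sum.swap)
qed

text \<open>A coloring of a disjoint union is a pair of colorings, and the types of the two halves
  record how the monomial splits in the product.\<close>

lemma coloring_gf_mult:
  assumes fin: "finite V" "finite W" and disj: "V \<inter> W = {}"
  shows "coloring_gf V f * coloring_gf W g =
    coloring_gf (V \<union> W) (\<lambda>\<kappa>. f (restrict \<kappa> V) * g (restrict \<kappa> W))"
proof (rule mfps_eqI)
  fix M :: "nat multiset"
  let ?F = "colorings_of_type :: 'a set \<Rightarrow> _"
  let ?P = "{(A, B). A + B = M}"
  have "mfps_coeff (coloring_gf V f * coloring_gf W g) M =
    (\<Sum>(A, B)\<in>?P. \<Sum>(\<kappa>, \<kappa>')\<in>?F V A \<times> ?F W B. f \<kappa> * g \<kappa>')"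
    unfolding mfps_coeff_mult coloring_gf_def mfps_coeff_Abs
    by (simp add: sum_product sum.cartesian_product)
  also have "\<dots> = (\<Sum>((A, B), (\<kappa>, \<kappa>'))\<in>Sigma ?P (\<lambda>(A, B). ?F V A \<times> ?F W B). f \<kappa> * g \<kappa>')"
    by (subst sum.Sigma[symmetric]) (auto simp: case_prod_beta finite_colorings_of_type fin)
  also have "\<dots> = (\<Sum>\<kappa>\<in>?F (V \<union> W) M. f (restrict \<kappa> V) * g (restrict \<kappa> W))"
  proof (rule sum.reindex_bij_witness[of _
        "\<lambda>\<kappa>. ((image_mset \<kappa> (mset_set V), image_mset \<kappa> (mset_set W)), (restrict \<kappa> V, restrict \<kappa> W))"
        "\<lambda>((A, B), (\<kappa>, \<kappa>')) x. if x \<in> V then \<kappa> x else \<kappa>' x"], goal_cases)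
    case (1 a)
    then obtain A B k k' where a: "a = ((A, B), (k, k'))" "A + B = M" "k \<in> ?F V A" "k' \<in> ?F W B"
      by auto
    let ?h = "\<lambda>x. if x \<in> V then k x else k' x"
    have "image_mset ?h (mset_set V) = A"
      using a(3) fin by (auto simp: colorings_of_type_def intro!: image_mset_cong)
    moreover have "image_mset ?h (mset_set W) = image_mset k' (mset_set W)"
      using fin disj by (intro image_mset_cong) auto
    moreover have "restrict ?h V = k" "restrict ?h W = k'"
      using a(3,4) disj by (auto simp: colorings_of_type_def restrict_def PiE_iff extensional_def fun_eq_iff)
    ultimately show ?case using a by (auto simp: colorings_of_type_def)
  next
    case (2 a)
    then obtain A B k k' where a: "a = ((A, B), (k, k'))" "A + B = M" "k \<in> ?F V A" "k' \<in> ?F W B"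
      by auto
    let ?h = "\<lambda>x. if x \<in> V then k x else k' x"
    have "image_mset ?h (mset_set V) = A"
      using a(3) fin by (auto simp: colorings_of_type_def intro!: image_mset_cong)
    moreover have "image_mset ?h (mset_set W) = image_mset k' (mset_set W)"
      using fin disj by (intro image_mset_cong) auto
    ultimately show ?case using a fin disj
      by (auto simp: colorings_of_type_def mset_set_Union PiE_iff extensional_def)
  next
    case (3 k)
    then show ?case by (auto simp: colorings_of_type_def PiE_iff extensional_def fun_eq_iff)
  next
    case (4 k)
    moreover have "image_mset (restrict k V) (mset_set V) = image_mset k (mset_set V)"
      "image_mset (restrict k W) (mset_set W) = image_mset k (mset_set W)"
      using fin by (auto intro!: image_mset_cong)
    ultimately show ?case using fin disj
      by (auto simp: colorings_of_type_def mset_set_Union)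
  next
    case (5 a)
    then obtain A B k k' where a: "a = ((A, B), (k, k'))" "k \<in> ?F V A" "k' \<in> ?F W B"
      by auto
    then have "restrict (\<lambda>x. if x \<in> V then k x else k' x) V = k"
      "restrict (\<lambda>x. if x \<in> V then k x else k' x) W = k'"
      using disj by (auto simp: colorings_of_type_def restrict_def PiE_iff extensional_def fun_eq_iff)
    with a show ?case by simp
  qed
  finally show "mfps_coeff (coloring_gf V f * coloring_gf W g) M =
      mfps_coeff (coloring_gf (V \<union> W) (\<lambda>\<kappa>. f (restrict \<kappa> V) * g (restrict \<kappa> W))) M"
    by (simp add: coloring_gf_def)
qed

lemma coloring_gf_empty: "coloring_gf {} (\<lambda>_. 1) = 1"
  by (rule mfps_eqI) (auto simp: coloring_gf_def colorings_of_type_def one_mfps_def)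

lemma coloring_gf_prod:
  assumes "finite P" "\<And>B. B \<in> P \<Longrightarrow> finite (U B)"
    "\<And>B B'. B \<in> P \<Longrightarrow> B' \<in> P \<Longrightarrow> B \<noteq> B' \<Longrightarrow> U B \<inter> U B' = {}"
  shows "(\<Prod>B\<in>P. coloring_gf (U B) (f B)) =
    coloring_gf (\<Union>B\<in>P. U B) (\<lambda>\<kappa>. \<Prod>B\<in>P. f B (restrict \<kappa> (U B)))"
  using assms
proof (induction P rule: finite_induct)
  case empty
  show ?case by (simp add: coloring_gf_empty)
next
  case (insert B P)
  have disj: "U B \<inter> (\<Union>B\<in>P. U B) = {}"
    using insert.prems(2)[of B] insert.hyps by blast
  have "(\<Prod>B\<in>insert B P. coloring_gf (U B) (f B)) =
     coloring_gf (U B) (f B) * coloring_gf (\<Union>B\<in>P. U B) (\<lambda>\<kappa>. \<Prod>B\<in>P. f B (restrict \<kappa> (U B)))"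
    unfolding prod.insert[OF insert.hyps] by (subst insert.IH) (use insert.prems in blast)+
  also have "\<dots> = coloring_gf (U B \<union> (\<Union>B\<in>P. U B))
      (\<lambda>\<kappa>. f B (restrict \<kappa> (U B)) * (\<Prod>B'\<in>P. f B' (restrict (restrict \<kappa> (\<Union>B\<in>P. U B)) (U B'))))"
    using insert.prems insert.hyps disj by (subst coloring_gf_mult) auto
  also have "\<dots> = coloring_gf (\<Union>B\<in>insert B P. U B)
      (\<lambda>\<kappa>. \<Prod>B'\<in>insert B P. f B' (restrict \<kappa> (U B')))"
  proof -
    have "(\<Union>B\<in>P. U B) \<inter> U B' = U B'" if "B' \<in> P" for B'
      using that by blast
    then show ?thesis
      using insert.hyps by (simp add: restrict_restrict Int_absorb2 cong: prod.cong)
  qed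
  finally show ?case .
qed

text \<open>Bridge from an arbitrary vertex set to the standard vertices on which
  \<open>star_sf\<close> is defined.\<close>

lemma coloring_gf_reindex:
  assumes "finite V" "bij_betw h V W"
  shows "coloring_gf W w = coloring_gf V (\<lambda>\<kappa>. w (\<lambda>y\<in>W. \<kappa> (inv_into V h y)))"
proof (rule mfps_eqI)
  fix M
  let ?g = "inv_into V h"
  have g: "bij_betw ?g W V" using assms(2) by (rule bij_betw_inv_into)
  have hg: "\<And>y. y \<in> W \<Longrightarrow> h (?g y) = y" "\<And>x. x \<in> V \<Longrightarrow> ?g (h x) = x"
    using assms(2) by (auto simp: bij_betw_inv_into_left bij_betw_inv_into_right)
  have memb: "\<And>y. y \<in> W \<Longrightarrow> ?g y \<in> V" "\<And>x. x \<in> V \<Longrightarrow> h x \<in> W"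
    using g assms(2) by (auto simp: bij_betw_def)
  have fW: "finite W" using assms bij_betw_finite by blast
  have V: "mset_set V = image_mset ?g (mset_set W)"
    using g by (simp add: bij_betw_def image_mset_mset_set)
  have W: "mset_set W = image_mset h (mset_set V)"
    using assms(2) by (simp add: bij_betw_def image_mset_mset_set)
  have "(\<Sum>\<kappa>\<in>colorings_of_type W M. w \<kappa>) =
    (\<Sum>\<kappa>\<in>colorings_of_type V M. w (\<lambda>y\<in>W. \<kappa> (?g y)))"
  proof (rule sum.reindex_bij_witness[of _ "\<lambda>\<kappa>. \<lambda>y\<in>W. \<kappa> (?g y)" "\<lambda>\<kappa>. \<lambda>x\<in>V. \<kappa> (h x)"], goal_cases)
    case (1 k)
    then show ?case using memb hg by (auto simp: colorings_of_type_def PiE_iff extensional_def fun_eq_iff)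
  next
    case (2 k)
    have "image_mset (\<lambda>x\<in>V. k (h x)) (mset_set V) = image_mset k (mset_set W)"
      unfolding W using assms(1) by (auto simp: multiset.map_comp intro!: image_mset_cong)
    with 2 show ?case by (auto simp: colorings_of_type_def)
  next
    case (3 k)
    then show ?case using memb hg by (auto simp: colorings_of_type_def PiE_iff extensional_def fun_eq_iff)
  next
    case (4 k)
    have "image_mset (\<lambda>y\<in>W. k (?g y)) (mset_set W) = image_mset k (mset_set V)"
      unfolding V using fW by (auto simp: multiset.map_comp intro!: image_mset_cong)
    with 4 show ?case by (auto simp: colorings_of_type_def)
  next
    case (5 k)
    have "(\<lambda>y\<in>W. (\<lambda>x\<in>V. k (h x)) (?g y)) = k"
      using 5 memb hg by (auto simp: colorings_of_type_def PiE_iff extensional_def fun_eq_iff)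
    then show ?case by simp
  qed
  then show "mfps_coeff (coloring_gf W w) M =
      mfps_coeff (coloring_gf V (\<lambda>\<kappa>. w (\<lambda>y\<in>W. \<kappa> (inv_into V h y)))) M"
    by (simp add: coloring_gf_def)
qed

text \<open>This is $\sum_i x_i^{|B|} (p_1 - x_i)^{|L|}$: a power sum if \<open>L\<close> is empty, a star if \<open>B\<close> is a
  singleton.\<close>

definition block_sf :: "'a set \<Rightarrow> 'a set \<Rightarrow> rat mfps" where
  "block_sf B L = coloring_gf (B \<union> L)
     (\<lambda>\<kappa>. of_bool ((\<forall>u\<in>B. \<forall>v\<in>B. \<kappa> u = \<kappa> v) \<and> (\<forall>u\<in>B. \<forall>v\<in>L. \<kappa> u \<noteq> \<kappa> v)))"

lemma block_sf_singleton:
  assumes "finite L" "v \<notin> L"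
  shows "block_sf {v} L = star_sf (Suc (card L))"
proof -
  define n where "n = Suc (card L)"
  obtain h0 where h0: "bij_betw h0 {1..<n} L"
    using assms(1) ex_bij_betw_nat_finite_1[OF assms(1)] unfolding n_def
    by (metis atLeastLessThanSuc_atLeastAtMost)
  define h where "h = (\<lambda>i. if i = 0 then v else h0 i)"
  have "bij_betw h {1..<n} L"
    using h0 by (rule bij_betw_cong[THEN iffD1, rotated]) (auto simp: h_def)
  moreover have "insert 0 {1..<n} = {0..<n}" by (auto simp: n_def)
  ultimately have h: "bij_betw h {0..<n} (insert v L)"
    using notIn_Un_bij_betw[of 0 "{1..<n}" h L] assms(2) by (simp add: h_def)
  have im: "h ` {1..<n} = L" using \<open>bij_betw h {1..<n} L\<close> by (simp add: bij_betw_def)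
  have inv: "inv_into {0..<n} h (h i) = i" if "i < n" for i
    using h that by (simp add: bij_betw_inv_into_left)
  have h0v: "h 0 = v" by (simp add: h_def)
  have inv0: "inv_into {0..<n} h v = 0" using inv[of 0] h0v by (simp add: n_def)
  have "block_sf {v} L = coloring_gf (insert v L) (\<lambda>\<kappa>. of_bool (\<forall>u\<in>L. \<kappa> v \<noteq> \<kappa> u))"
    by (simp add: block_sf_def)
  also have "\<dots> = coloring_gf {0..<n} (\<lambda>\<kappa>. of_bool (\<forall>i\<in>{1..<n}. \<kappa> 0 \<noteq> \<kappa> i))"
    unfolding coloring_gf_reindex[OF finite_atLeastLessThan h]
  proof (rule coloring_gf_cong)
    fix k :: "nat \<Rightarrow> nat"
    show "of_bool (\<forall>u\<in>L. (\<lambda>y\<in>insert v L. k (inv_into {0..<n} h y)) v \<noteq>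
            (\<lambda>y\<in>insert v L. k (inv_into {0..<n} h y)) u) =
          of_bool (\<forall>i\<in>{1..<n}. k 0 \<noteq> k i)"
      unfolding im[symmetric] by (auto simp: inv inv0)
  qed
  also have "\<dots> = star_sf n"
    unfolding star_sf_def
  proof (subst chromatic_sf_eq_gf, simp, rule coloring_gf_cong)
    fix k :: "nat \<Rightarrow> nat"
    have "(\<forall>i\<in>{1..<n}. k 0 \<noteq> k i) \<longleftrightarrow>
      (\<forall>u v. {u, v} \<in> {{0, i} |i. i \<in> {1..<n}} \<longrightarrow> k u \<noteq> k v)"
    proof (intro iffI allI impI ballI)
      fix i assume *: "\<forall>u v. {u, v} \<in> {{0, i} |i. i \<in> {1..<n}} \<longrightarrow> k u \<noteq> k v" and "i \<in> {1..<n}"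
      then have "{0, i} \<in> {{0, i} |i. i \<in> {1..<n}}" by blast
      with * show "k 0 \<noteq> k i" by blast
    next
      fix u v assume *: "\<forall>i\<in>{1..<n}. k 0 \<noteq> k i" and "{u, v} \<in> {{0, i} |i. i \<in> {1..<n}}"
      then obtain i where i: "i \<in> {1..<n}" "u = 0 \<and> v = i \<or> u = i \<and> v = 0"
        by (auto simp: doubleton_eq_iff)
      from * i(1) have "k 0 \<noteq> k i" by (rule bspec)
      with i(2) show "k u \<noteq> k v" by auto
    qed
    then show "of_bool (\<forall>i\<in>{1..<n}. k 0 \<noteq> k i) = (of_bool
       (\<forall>u v. {u, v} \<in> {{0, i} |i. i \<in> {1..<n}} \<longrightarrow> k u \<noteq> k v) :: rat)"
      by (simp only:)
  qed
  finally show ?thesis by (simp add: n_def)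
qed

text \<open>The factor \<open>star_sf 1\<close> is a vertex u of free colour. Either u has the
  common colour of B and joins the block, or it has another colour and joins the vertices that must
  avoid the colour of B. For a single colour i this is x_i = p_1 - (p_1 - x_i).\<close>

lemma block_sf_insert:
  assumes "finite B" "finite L" "B \<noteq> {}" "u \<notin> B" "u \<notin> L"
  shows "block_sf (insert u B) L = star_sf 1 * block_sf B L - block_sf B (insert u L)"
proof -
  obtain b where b: "b \<in> B" using assms by blast
  have "star_sf 1 = block_sf {u} {}" by (simp add: block_sf_singleton)
  then have "star_sf 1 * block_sf B L = coloring_gf ({u} \<union> (B \<union> L)) (\<lambda>\<kappa>. of_bool
     ((\<forall>u\<in>B. \<forall>v\<in>B. \<kappa> u = \<kappa> v) \<and> (\<forall>u\<in>B. \<forall>v\<in>L. \<kappa> u \<noteq> \<kappa> v)))"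
    unfolding block_sf_def using assms
    by (simp add: coloring_gf_mult del: Un_insert_left Un_insert_right)
  moreover have "insert u B \<union> L = {u} \<union> (B \<union> L)" "B \<union> insert u L = {u} \<union> (B \<union> L)" by auto
  moreover have "of_bool ((\<forall>x\<in>insert u B. \<forall>y\<in>insert u B. \<kappa> x = \<kappa> y) \<and> (\<forall>x\<in>insert u B. \<forall>y\<in>L. \<kappa> x \<noteq> \<kappa> y)) =
    of_bool ((\<forall>x\<in>B. \<forall>y\<in>B. \<kappa> x = \<kappa> y) \<and> (\<forall>x\<in>B. \<forall>y\<in>L. \<kappa> x \<noteq> \<kappa> y)) -
    (of_bool ((\<forall>x\<in>B. \<forall>y\<in>B. \<kappa> x = \<kappa> y) \<and> (\<forall>x\<in>B. \<forall>y\<in>insert u L. \<kappa> x \<noteq> \<kappa> y)) :: rat)"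
    for \<kappa> :: "'a \<Rightarrow> nat"
  proof (cases "\<exists>c. (\<forall>x\<in>B. \<kappa> x = c) \<and> (\<forall>y\<in>L. c \<noteq> \<kappa> y)")
    case True
    then obtain c where c: "\<And>x. x \<in> B \<Longrightarrow> \<kappa> x = c" "\<And>y. y \<in> L \<Longrightarrow> c \<noteq> \<kappa> y" by blast
    then have "(\<forall>x\<in>B. \<forall>y\<in>B. \<kappa> x = \<kappa> y)" "(\<forall>x\<in>B. \<forall>y\<in>L. \<kappa> x \<noteq> \<kappa> y)"
      by simp_all
    moreover have "(\<forall>x\<in>insert u B. \<forall>y\<in>insert u B. \<kappa> x = \<kappa> y) \<longleftrightarrow> \<kappa> u = c"
      using c b by auto
    moreover have "(\<forall>x\<in>insert u B. \<forall>y\<in>L. \<kappa> x \<noteq> \<kappa> y) \<longleftrightarrow> (\<forall>y\<in>L. \<kappa> u \<noteq> \<kappa> y)"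
      "(\<forall>x\<in>B. \<forall>y\<in>insert u L. \<kappa> x \<noteq> \<kappa> y) \<longleftrightarrow> \<kappa> u \<noteq> c"
      using c b by auto
    ultimately show ?thesis using c by (cases "\<kappa> u = c") simp_all
  next
    case False
    then have "\<not> ((\<forall>x\<in>B. \<forall>y\<in>B. \<kappa> x = \<kappa> y) \<and> (\<forall>x\<in>B. \<forall>y\<in>L. \<kappa> x \<noteq> \<kappa> y))"
      using b by metis
    moreover from this have "\<not> ((\<forall>x\<in>insert u B. \<forall>y\<in>insert u B. \<kappa> x = \<kappa> y) \<and> (\<forall>x\<in>insert u B. \<forall>y\<in>L. \<kappa> x \<noteq> \<kappa> y))"
      "\<not> ((\<forall>x\<in>B. \<forall>y\<in>B. \<kappa> x = \<kappa> y) \<and> (\<forall>x\<in>B. \<forall>y\<in>insert u L. \<kappa> x \<noteq> \<kappa> y))"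
      by blast+
    ultimately show ?thesis by (simp only: of_bool_eq if_False diff_self)
  qed
  ultimately show ?thesis
    unfolding block_sf_def by (simp only: coloring_gf_diff)
qed

section \<open>Star expansions and their leading terms\<close>

text \<open>Indexed by multisets, so that multiplying star products means adding their
  indices.\<close>

definition star_prod :: "nat multiset \<Rightarrow> rat mfps" where
  "star_prod m = (\<Prod>k\<in>#m. star_sf k)"

definition part_msets :: "nat \<Rightarrow> nat multiset set" where
  "part_msets n = {m. \<Sum>\<^sub># m = n \<and> 0 \<notin># m}"

lemma star_prod_add: "star_prod (m + m') = star_prod m * star_prod m'"
  by (simp add: star_prod_def)

lemma part_msets_add: "m \<in> part_msets n \<Longrightarrow> m' \<in> part_msets n' \<Longrightarrow> m + m' \<in> part_msets (n + n')"
  by (auto simp: part_msets_def)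

lemma bij_betw_partitions: "bij_betw mset (partitions n) (part_msets n)"
proof (rule bij_betwI[where g = "\<lambda>m. rev (sorted_list_of_multiset m)"])
  show "mset \<in> partitions n \<rightarrow> part_msets n"
    by (auto simp: partitions_def part_msets_def sum_mset_sum_list)
  show "(\<lambda>m. rev (sorted_list_of_multiset m)) \<in> part_msets n \<rightarrow> partitions n"
  proof
    fix m assume "m \<in> part_msets n"
    moreover have "sorted_wrt (\<ge>) (rev (sorted_list_of_multiset m))"
      by (simp add: sorted_wrt_rev)
    moreover have "sum_list (rev (sorted_list_of_multiset m)) = \<Sum>\<^sub># m"
      by (metis mset_rev mset_sorted_list_of_multiset sum_mset_sum_list)
    ultimately show "rev (sorted_list_of_multiset m) \<in> partitions n"
      by (auto simp: partitions_def part_msets_def intro!: gr0I)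
  qed
  fix xs assume "xs \<in> partitions n"
  then have "sorted (rev xs)" by (simp add: partitions_def sorted_wrt_rev)
  then show "rev (sorted_list_of_multiset (mset xs)) = xs"
    by (metis mset_rev rev_rev_ident sorted_list_of_multiset_mset sorted_sort_id)
qed simp

lemma finite_part_msets: "finite (part_msets n)"
  using bij_betw_finite[OF bij_betw_partitions] finite_partitions by blast

text \<open>Provides span, independence and the dimension bound, on which the uniqueness of star
  coefficients rests.\<close>

interpretation mfps: vector_space "mfps_scale :: rat \<Rightarrow> rat mfps \<Rightarrow> rat mfps"
  by unfold_locales
     (auto intro!: mfps_eqI simp: mfps_scale_def plus_mfps_def algebra_simps)

lemma mfps_scale_mult: "mfps_scale a f * mfps_scale b g = mfps_scale (a * b) (f * g)"
  by (rule mfps_eqI)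
     (simp add: mfps_scale_def times_mfps_def sum_distrib_left case_prod_beta mult_ac)

text \<open>Multisets are compared by the multiset order, which on the partitions of \<open>n\<close> is the
  lexicographic order and which, unlike the latter, is visibly compatible with products. The
  coefficient \<open>a\<close> at \<open>m\<close> may be zero.\<close>

definition star_lead :: "nat \<Rightarrow> nat multiset \<Rightarrow> rat \<Rightarrow> rat mfps \<Rightarrow> bool" where
  "star_lead n m a f \<longleftrightarrow> (\<exists>c. f = (\<Sum>m'\<in>part_msets n. mfps_scale (c m') (star_prod m')) \<and>
     c m = a \<and> (\<forall>m'<m. c m' = 0))"

text \<open>Lets a summand whose lead lies above the target index be counted there with coefficient
  0, so that all summands can share one index.\<close>

lemma star_lead_weaken:
  assumes "star_lead n m' a f" "m < m'"
  shows "star_lead n m 0 f"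
proof -
  obtain c where "f = (\<Sum>m'\<in>part_msets n. mfps_scale (c m') (star_prod m'))" "\<forall>m''<m'. c m'' = 0"
    using assms(1) unfolding star_lead_def by blast
  with assms(2) show ?thesis unfolding star_lead_def by (intro exI[of _ c]) auto
qed

lemma star_lead_0: "star_lead n m 0 0"
  unfolding star_lead_def by (rule exI[of _ "\<lambda>_. 0"]) simp

lemma star_lead_add:
  assumes "star_lead n m a f" "star_lead n m b g"
  shows "star_lead n m (a + b) (f + g)"
proof -
  obtain c d where "f = (\<Sum>m'\<in>part_msets n. mfps_scale (c m') (star_prod m'))" "c m = a" "\<forall>m'<m. c m' = 0"
    "g = (\<Sum>m'\<in>part_msets n. mfps_scale (d m') (star_prod m'))" "d m = b" "\<forall>m'<m. d m' = 0"
    using assms unfolding star_lead_def by blast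
  then show ?thesis unfolding star_lead_def
    by (intro exI[of _ "\<lambda>m. c m + d m"]) (simp add: sum.distrib mfps.scale_left_distrib)
qed

lemma star_lead_uminus:
  assumes "star_lead n m a f"
  shows "star_lead n m (- a) (- f)"
proof -
  obtain c where "f = (\<Sum>m'\<in>part_msets n. mfps_scale (c m') (star_prod m'))" "c m = a" "\<forall>m'<m. c m' = 0"
    using assms unfolding star_lead_def by blast
  then show ?thesis unfolding star_lead_def
    by (intro exI[of _ "\<lambda>m. - c m"]) (simp add: sum_negf)
qed

lemma star_lead_sign:
  assumes "star_lead n m a f"
  shows "star_lead n m ((-1) ^ k * a) ((-1) ^ k * f)"
  by (induction k) (auto simp: assms dest: star_lead_uminus)

lemma star_lead_sum:
  assumes "\<And>i. i \<in> A \<Longrightarrow> star_lead n m (a i) (f i)"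
  shows "star_lead n m (\<Sum>i\<in>A. a i) (\<Sum>i\<in>A. f i)"
  using assms by (induction A rule: infinite_finite_induct) (auto simp: star_lead_0 star_lead_add)

lemma star_lead_star_prod:
  assumes "m \<in> part_msets n"
  shows "star_lead n m 1 (star_prod m)"
proof -
  have "(\<Sum>m'\<in>part_msets n. mfps_scale (of_bool (m' = m)) (star_prod m')) =
      (\<Sum>m'\<in>{m}. mfps_scale (of_bool (m' = m)) (star_prod m'))"
    using assms by (intro sum.mono_neutral_right) (auto simp: finite_part_msets)
  then show ?thesis unfolding star_lead_def
    by (intro exI[of _ "\<lambda>m'. of_bool (m' = m)"]) auto
qed

text \<open>The multiset order is total and strictly compatible with addition, so a pair of indices
  other than (m, m') with sum at most m + m' has a component below its lead, where the coefficient
  is zero. Membership of m and m' ensures that this pair really occurs in the product, as only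
  coefficients at indices in \<open>part_msets\<close> enter the series.\<close>

lemma star_lead_mult:
  assumes f: "star_lead n m a f" and g: "star_lead n' m' a' g"
    and m: "m \<in> part_msets n" "m' \<in> part_msets n'"
  shows "star_lead (n + n') (m + m') (a * a') (f * g)"
proof -
  obtain c where c: "f = (\<Sum>m'\<in>part_msets n. mfps_scale (c m') (star_prod m'))" "c m = a" "\<forall>m'<m. c m' = 0"
    using f unfolding star_lead_def by blast
  obtain d where d: "g = (\<Sum>m'\<in>part_msets n'. mfps_scale (d m') (star_prod m'))" "d m' = a'" "\<forall>m<m'. d m = 0"
    using g unfolding star_lead_def by blast
  let ?R = "part_msets n \<times> part_msets n'"
  \<comment> \<open>Different pairs of indices may have the same sum, so their contributions are
    collected.\<close>
  define e where "e = (\<lambda>M. \<Sum>(A, B) | (A, B) \<in> ?R \<and> A + B = M. c A * d B)"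
  have fin: "finite ?R" by (simp add: finite_part_msets)
  have "f * g = (\<Sum>(A, B)\<in>?R. mfps_scale (c A * d B) (star_prod (A + B)))"
    unfolding c(1) d(1)
    by (simp add: sum_product sum.cartesian_product mfps_scale_mult star_prod_add)
  also have "\<dots> = (\<Sum>M\<in>part_msets (n + n').
      \<Sum>x | x \<in> ?R \<and> (case x of (A, B) \<Rightarrow> A + B) = M. case x of (A, B) \<Rightarrow> mfps_scale (c A * d B) (star_prod (A + B)))"
    using fin finite_part_msets[of "n + n'"]
    by (subst sum.group) (auto intro: part_msets_add)
  also have "\<dots> = (\<Sum>M\<in>part_msets (n + n'). mfps_scale (e M) (star_prod M))"
  proof (rule sum.cong[OF refl])
    fix M
    have "(\<Sum>x | x \<in> ?R \<and> (case x of (A, B) \<Rightarrow> A + B) = M. case x of (A, B) \<Rightarrow> mfps_scale (c A * d B) (star_prod (A + B)))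
      = (\<Sum>x | x \<in> ?R \<and> (case x of (A, B) \<Rightarrow> A + B) = M. mfps_scale (case x of (A, B) \<Rightarrow> c A * d B) (star_prod M))"
      by (rule sum.cong) auto
    also have "\<dots> = mfps_scale (e M) (star_prod M)"
      unfolding e_def mfps.scale_sum_left[symmetric]
      by (intro arg_cong[where f = "\<lambda>x. mfps_scale x (star_prod M)"] sum.cong) auto
    finally show "(\<Sum>x | x \<in> ?R \<and> (case x of (A, B) \<Rightarrow> A + B) = M.
      case x of (A, B) \<Rightarrow> mfps_scale (c A * d B) (star_prod (A + B))) = mfps_scale (e M) (star_prod M)" .
  qed
  finally have fg: "f * g = (\<Sum>M\<in>part_msets (n + n'). mfps_scale (e M) (star_prod M))" .
  have zero: "c A * d B = 0" if "A + B \<le> m + m'" "(A, B) \<noteq> (m, m')" for A B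
  proof (cases "A < m \<or> B < m'")
    case True
    then show ?thesis using c d by auto
  next
    case False
    then have "m \<le> A" "m' \<le> B" by (auto simp: not_less)
    moreover from this have "m < A \<or> m' < B" using that(2) by auto
    ultimately have "m + m' < A + B" by (meson add_less_le_mono add_le_less_mono)
    with that(1) show ?thesis by auto
  qed
  have "e M = 0" if "M < m + m'" for M
    unfolding e_def using that by (intro sum.neutral) (auto simp del: mult_eq_0_iff intro!: zero)
  moreover have "e (m + m') = (\<Sum>(A, B)\<in>{(m, m')}. c A * d B)"
    unfolding e_def using m
    by (intro sum.mono_neutral_right) (auto intro: zero finite_subset[OF _ fin])
  ultimately show ?thesis unfolding star_lead_def using fg c(2) d(2)
    by (intro exI[of _ e]) auto
qed

text \<open>Membership in \<open>part_msets\<close> is part of the conclusion because each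
  multiplication in the induction asks for it.\<close>

lemma star_lead_prod:
  assumes "\<And>i. i \<in> A \<Longrightarrow> star_lead (n i) (m i) (a i) (f i)"
    and "\<And>i. i \<in> A \<Longrightarrow> m i \<in> part_msets (n i)"
  shows "star_lead (\<Sum>i\<in>A. n i) (\<Sum>i\<in>A. m i) (\<Prod>i\<in>A. a i) (\<Prod>i\<in>A. f i) \<and>
    (\<Sum>i\<in>A. m i) \<in> part_msets (\<Sum>i\<in>A. n i)"
proof -
  have 1: "star_lead 0 {#} 1 1" "{#} \<in> part_msets 0"
    using star_lead_star_prod[of "{#}" 0] by (auto simp: part_msets_def star_prod_def)
  show ?thesis
    using assms by (induction A rule: infinite_finite_induct)
      (auto simp: 1 intro: star_lead_mult part_msets_add)
qed

lemma block_part_msets: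
  "add_mset (Suc j) (replicate_mset i 1) \<in> part_msets (Suc i + j)"
  by (auto simp: part_msets_def)

text \<open>Induction by \<open>block_sf_insert\<close>: the factor \<open>star_sf 1\<close> adds a
  part 1 to the lead, while the subtracted block has one more vertex in L, hence a larger greatest
  part, and contributes 0 at this index. L is arbitrary in the induction since the new vertex moves
  into it.\<close>

lemma star_lead_block:
  assumes "finite B" "B \<noteq> {}" "finite L" "B \<inter> L = {}"
  shows "star_lead (card B + card L) (add_mset (Suc (card L)) (replicate_mset (card B - 1) 1)) 1 (block_sf B L)"
  using assms
proof (induction B arbitrary: L rule: finite_ne_induct)
  case (singleton v)
  have "star_prod {#Suc (card L)#} = block_sf {v} L"
    using singleton by (simp add: star_prod_def block_sf_singleton)
  then show ?case using star_lead_star_prod[of "{#Suc (card L)#}" "Suc (card L)"]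
    by (simp add: part_msets_def)
next
  case (insert u B)
  have cB: "card B = Suc (card B - 1)" using insert by (metis Suc_pred card_gt_0_iff diff_Suc_1)
  let ?m = "add_mset (Suc (card L)) (replicate_mset (card B - 1) 1)"
  have "star_lead 1 {#1#} 1 (star_sf 1)"
    using star_lead_star_prod[of "{#1#}" 1] by (simp add: part_msets_def star_prod_def)
  moreover have "star_lead (card B + card L) ?m 1 (block_sf B L)"
    using insert by simp
  ultimately have "star_lead (1 + (card B + card L)) ({#1#} + ?m) (1 * 1) (star_sf 1 * block_sf B L)"
    using block_part_msets[of "card L" "card B - 1"] cB
    by (intro star_lead_mult) (auto simp: part_msets_def)
  moreover have "{#1#} + ?m = add_mset (Suc (card L)) (replicate_mset (card B) 1)"
    by (subst (2) cB) simp
  ultimately have 1: "star_lead (1 + (card B + card L)) (add_mset (Suc (card L)) (replicate_mset (card B) 1)) 1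
      (star_sf 1 * block_sf B L)" by simp
  have "star_lead (card B + card (insert u L)) (add_mset (Suc (card (insert u L))) (replicate_mset (card B - 1) 1)) 1
      (block_sf B (insert u L))"
    using insert.prems insert.hyps by (intro insert.IH) auto
  then have "star_lead (1 + (card B + card L)) (add_mset (Suc (card L)) (replicate_mset (card B) 1)) 0
      (block_sf B (insert u L))"
    using insert.prems
    by (auto elim!: star_lead_weaken intro!: ex_gt_imp_less_multiset exI[of _ "Suc (Suc (card L))"]
        simp: card_insert_if split: if_splits)
  from star_lead_add[OF 1 star_lead_uminus[OF this]]
  show ?case using insert by (simp add: block_sf_insert card_insert_if)
qed

section \<open>Uniqueness of star coefficients\<close>

text \<open>The power sum p_k, taken as a block without leaves so that its star expansion is a case
  of \<open>star_lead_block\<close>.\<close>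

definition power_sf :: "nat \<Rightarrow> rat mfps" where
  "power_sf k = block_sf {..<k} ({} :: nat set)"

definition power_prod :: "nat multiset \<Rightarrow> rat mfps" where
  "power_prod m = (\<Prod>k\<in>#m. power_sf k)"

lemma power_sf_coeff:
  "mfps_coeff (power_sf k) M =
    (\<Sum>\<kappa>\<in>colorings_of_type {..<k} M. of_bool (\<forall>u<k. \<forall>v<k. \<kappa> u = \<kappa> v))"
  by (simp add: power_sf_def block_sf_def coloring_gf_def lessThan_def)

lemma power_sf_coeff_nonneg: "mfps_coeff (power_sf k) M \<ge> 0"
  by (simp add: power_sf_coeff sum_nonneg)

lemma power_sf_coeff_neq_0:
  assumes "mfps_coeff (power_sf k) M \<noteq> 0" "k > 0"
  shows "\<exists>i. M = replicate_mset k i"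
proof -
  have "\<exists>\<kappa>\<in>colorings_of_type {..<k} M. \<forall>u<k. \<forall>v<k. \<kappa> u = \<kappa> v"
    using assms(1) unfolding power_sf_coeff by (rule contrapos_np) (auto intro!: sum.neutral)
  then obtain \<kappa> where k: "image_mset \<kappa> (mset_set {..<k}) = M" "\<And>u v. u < k \<Longrightarrow> v < k \<Longrightarrow> \<kappa> u = \<kappa> v"
    unfolding colorings_of_type_def by blast
  have "image_mset \<kappa> (mset_set {..<k}) = image_mset (\<lambda>_. \<kappa> 0) (mset_set {..<k})"
    using assms(2) by (intro image_mset_cong k(2)) auto
  then have "M = image_mset (\<lambda>_. \<kappa> 0) (mset_set {..<k})" by (simp add: k(1))
  then show ?thesis by (auto simp: image_mset_const_eq)
qed

lemma power_sf_coeff_replicate: "mfps_coeff (power_sf k) (replicate_mset k i) > 0"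
proof -
  let ?\<kappa> = "\<lambda>x\<in>{..<k}. i"
  have "image_mset ?\<kappa> (mset_set {..<k}) = image_mset (\<lambda>_. i) (mset_set {..<k})"
    by (intro image_mset_cong) simp
  then have "?\<kappa> \<in> colorings_of_type {..<k} (replicate_mset k i)"
    by (simp add: colorings_of_type_def image_mset_const_eq)
  then show ?thesis unfolding power_sf_coeff
    by (intro sum_pos2[of _ ?\<kappa>]) (auto simp: finite_colorings_of_type)
qed

text \<open>Multiplying by a power sum adds one part to the exponents of a monomial or enlarges an existing
  one, so the exponents of a monomial of a product of power sums have at most as many parts as there
  are factors, with equality only if they are the degrees of the factors.\<close>

definition exponents :: "nat multiset \<Rightarrow> nat multiset" where
  "exponents M = image_mset (count M) (mset_set (set_mset M))"

lemma exponents_add_replicate: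
  assumes "i \<notin># M" "k > 0"
  shows "exponents (replicate_mset k i + M) = add_mset k (exponents M)"
proof -
  have set: "set_mset (replicate_mset k i + M) = insert i (set_mset M)" using assms by auto
  have "image_mset (count (replicate_mset k i + M)) (mset_set (set_mset M)) =
      image_mset (count M) (mset_set (set_mset M))"
    using assms by (intro image_mset_cong) auto
  then show ?thesis unfolding exponents_def set using assms
    by (simp add: not_in_iff)
qed

lemma size_exponents: "size (exponents M) = card (set_mset M)"
  by (simp add: exponents_def)

lemma exponents_surj: "0 \<notin># m \<Longrightarrow> \<exists>M. exponents M = m"
proof (induction m)
  case empty
  show ?case by (rule exI[of _ "{#}"]) (simp add: exponents_def)
next
  case (add k m)
  then obtain M where "exponents M = m" by auto
  moreover obtain i where "i \<notin># M" using ex_new_if_finite[of "set_mset M"] by auto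
  ultimately show ?case using exponents_add_replicate[of i M k] add.prems by auto
qed

text \<open>Excludes cancellation: a single positive summand then makes a coefficient
  positive.\<close>

lemma power_prod_coeff_nonneg: "mfps_coeff (power_prod m) M \<ge> 0"
proof (induction m arbitrary: M)
  case empty
  show ?case by (simp add: power_prod_def one_mfps_def)
next
  case (add k m)
  then show ?case
    by (auto simp: power_prod_def mfps_coeff_mult intro!: sum_nonneg mult_nonneg_nonneg power_sf_coeff_nonneg)
qed

lemma power_prod_coeff_neq_0:
  assumes "mfps_coeff (power_prod m) M \<noteq> 0" "0 \<notin># m"
  shows "exponents M = m \<or> size (exponents M) < size m"
  using assms
proof (induction m arbitrary: M)
  case empty
  then show ?case by (auto simp: power_prod_def one_mfps_def exponents_def split: if_splits)
next
  case (add k m)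
  have "\<exists>A B. A + B = M \<and> mfps_coeff (power_sf k) A * mfps_coeff (power_prod m) B \<noteq> 0"
  proof (rule ccontr)
    assume "\<nexists>A B. A + B = M \<and> mfps_coeff (power_sf k) A * mfps_coeff (power_prod m) B \<noteq> 0"
    then have "mfps_coeff (power_sf k * power_prod m) M = 0"
      unfolding mfps_coeff_mult by (intro sum.neutral) auto
    with add.prems show False by (simp add: power_prod_def)
  qed
  then obtain A B where AB: "A + B = M" "mfps_coeff (power_sf k) A \<noteq> 0" "mfps_coeff (power_prod m) B \<noteq> 0"
    by auto
  have k: "k > 0" using add.prems by auto
  obtain i where i: "A = replicate_mset k i" using power_sf_coeff_neq_0 AB k by blast
  have IH: "exponents B = m \<or> size (exponents B) < size m" using add AB by auto
  show ?case
  proof (cases "i \<in># B")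
    case True
    then have "set_mset M = set_mset B" using AB(1) i by (auto split: if_splits)
    then show ?thesis using IH by (auto simp: size_exponents)
  next
    case False
    then show ?thesis using IH exponents_add_replicate[OF False k] AB(1) i by auto
  qed
qed

lemma power_prod_coeff_exponents:
  assumes "exponents M = m" "0 \<notin># m"
  shows "mfps_coeff (power_prod m) M > 0"
  using assms
proof (induction m arbitrary: M)
  case empty
  then have "M = {#}" by (simp add: exponents_def mset_set_empty_iff)
  then show ?case by (simp add: power_prod_def one_mfps_def)
next
  case (add k m)
  then have "k \<in># exponents M" by simp
  then obtain i where i: "i \<in># M" "count M i = k" by (auto simp: exponents_def)
  \<comment> \<open>One variable of exponent k is split off completely; it is supplied by the factor
    \<open>power_sf k\<close>, and the remaining monomial has exponents m.\<close>
  define B where "B = filter_mset (\<lambda>x. x \<noteq> i) M"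
  have M: "replicate_mset k i + B = M"
    using i by (auto simp: B_def multiset_eq_iff)
  have "exponents M = add_mset k (exponents B)"
    using exponents_add_replicate[of i B k] M add.prems by (auto simp: B_def)
  then have pos: "mfps_coeff (power_prod m) B > 0" using add by simp
  have "0 < (\<Sum>(A, B) | A + B = M. mfps_coeff (power_sf k) A * mfps_coeff (power_prod m) B)"
    using M pos power_sf_coeff_replicate[of k i]
    by (intro sum_pos2[of _ "(replicate_mset k i, B)"])
       (auto intro: mult_nonneg_nonneg power_sf_coeff_nonneg power_prod_coeff_nonneg)
  then show ?case by (simp add: power_prod_def mfps_coeff_mult)
qed

text \<open>Triangularity in the number of parts: let p have the most parts among the indices with
  nonzero coefficient. A monomial with exponents p occurs in the product of another index only if
  that index has more parts, so p alone contributes to it.\<close>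

lemma power_prod_independent:
  assumes eq: "(\<Sum>m\<in>part_msets n. mfps_scale (c m) (power_prod m)) = 0" and m: "m \<in> part_msets n"
  shows "c m = 0"
proof (rule ccontr)
  assume "c m \<noteq> 0"
  define S where "S = {m \<in> part_msets n. c m \<noteq> 0}"
  have S: "finite S" "S \<noteq> {}" using m \<open>c m \<noteq> 0\<close> by (auto simp: S_def finite_part_msets)
  then have "Max (size ` S) \<in> size ` S" by simp
  then obtain p where p: "p \<in> S" "size p = Max (size ` S)" by auto
  have max: "size q \<le> size p" if "q \<in> S" for q using that S p(2) by simp
  obtain M where M: "exponents M = p"
    using exponents_surj[of p] p by (auto simp: S_def part_msets_def)
  have "(\<Sum>m\<in>part_msets n. c m * mfps_coeff (power_prod m) M) = 0"
    using arg_cong[OF eq, of "\<lambda>f. mfps_coeff f M"]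
    by (simp add: mfps_coeff_sum mfps_scale_def mfps_coeff_0)
  also have "(\<Sum>m\<in>part_msets n. c m * mfps_coeff (power_prod m) M) =
     (\<Sum>m\<in>{p}. c m * mfps_coeff (power_prod m) M)"
  proof (intro sum.mono_neutral_right ballI)
    fix q assume q: "q \<in> part_msets n - {p}"
    show "c q * mfps_coeff (power_prod q) M = 0"
    proof (rule ccontr)
      assume *: "c q * mfps_coeff (power_prod q) M \<noteq> 0"
      then have "size q \<le> size p" using q by (intro max) (auto simp: S_def)
      moreover have "size p < size q"
        using power_prod_coeff_neq_0[of q M] * q M by (auto simp: part_msets_def)
      ultimately show False by simp
    qed
  qed (use p in \<open>auto simp: S_def finite_part_msets\<close>)
  finally show False
    using power_prod_coeff_exponents[OF M] p by (auto simp: S_def part_msets_def)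
qed

text \<open>Supplies for each power sum product an expansion into star products of the same
  degree.\<close>

lemma star_lead_power_prod:
  assumes "0 \<notin># m"
  shows "\<exists>p. star_lead (\<Sum>\<^sub># m) p 1 (power_prod m) \<and> p \<in> part_msets (\<Sum>\<^sub># m)"
  using assms
proof (induction m)
  case empty
  show ?case using star_lead_star_prod[of "{#}" 0]
    by (intro exI[of _ "{#}"]) (auto simp: power_prod_def star_prod_def part_msets_def)
next
  case (add k m)
  then obtain p where p: "star_lead (\<Sum>\<^sub># m) p 1 (power_prod m)" "p \<in> part_msets (\<Sum>\<^sub># m)" by auto
  have k: "k > 0" using add.prems by auto
  have "star_lead k (add_mset (Suc 0) (replicate_mset (k - 1) 1)) 1 (power_sf k)"
    using star_lead_block[of "{..<k}" "{}"] k by (simp add: power_sf_def lessThan_empty_iff)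
  moreover have q: "add_mset (Suc 0) (replicate_mset (k - 1) 1) \<in> part_msets k"
    using block_part_msets[of 0 "k - 1"] k by simp
  ultimately have "star_lead (k + \<Sum>\<^sub># m) (add_mset (Suc 0) (replicate_mset (k - 1) 1) + p) (1 * 1)
      (power_sf k * power_prod m)"
    using p by (intro star_lead_mult)
  then show ?case using part_msets_add[OF q p(2)]
    by (intro exI[of _ "add_mset (Suc 0) (replicate_mset (k - 1) 1) + p"]) (simp add: power_prod_def)
qed

lemma star_prod_independent:
  assumes eq: "(\<Sum>m\<in>part_msets n. mfps_scale (c m) (star_prod m)) = 0" and p: "p \<in> part_msets n"
  shows "c p = 0"
proof (rule ccontr)
  assume cp: "c p \<noteq> 0"
  let ?P = "part_msets n"
  let ?T = "star_prod ` (?P - {p})"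
  have fin: "finite ?P" by (rule finite_part_msets)
  \<comment> \<open>The dimension bound counts the elements of a set, so distinct indices must give
    distinct products; a coincidence would itself be a linear relation.\<close>
  have inj: "inj_on power_prod ?P"
  proof (rule inj_onI, rule ccontr)
    fix x y assume xy: "x \<in> ?P" "y \<in> ?P" "power_prod x = power_prod y" "x \<noteq> y"
    let ?c = "\<lambda>m. of_bool (m = x) - of_bool (m = y) :: rat"
    have "(\<Sum>m\<in>?P. mfps_scale (?c m) (power_prod m)) = (\<Sum>m\<in>{x, y}. mfps_scale (?c m) (power_prod m))"
      using xy fin by (intro sum.mono_neutral_right) auto
    also have "\<dots> = 0" using xy by simp
    finally have "?c x = 0" using xy(1) by (rule power_prod_independent)
    with xy(4) show False by simp
  qed
  have ind: "mfps.independent (power_prod ` ?P)"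
  proof
    assume "mfps.dependent (power_prod ` ?P)"
    then obtain u x where u: "x \<in> power_prod ` ?P" "u x \<noteq> 0" "(\<Sum>v\<in>power_prod ` ?P. mfps_scale (u v) v) = 0"
      using fin by (subst (asm) mfps.dependent_finite) auto
    from u(3) have "(\<Sum>m\<in>?P. mfps_scale (u (power_prod m)) (power_prod m)) = 0"
      by (simp add: sum.reindex[OF inj])
    from power_prod_independent[OF this] u(1,2) show False by auto
  qed
  \<comment> \<open>A relation with nonzero coefficient at p can be solved for
    \<open>star_prod p\<close>.\<close>
  have sp: "star_prod p \<in> mfps.span ?T"
  proof -
    have "mfps_scale (c p) (star_prod p) = - (\<Sum>m\<in>?P - {p}. mfps_scale (c m) (star_prod m))"
      using eq fin p by (simp add: sum.remove eq_neg_iff_add_eq_0)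
    also have "\<dots> \<in> mfps.span ?T"
      by (intro mfps.span_neg mfps.span_sum mfps.span_scale mfps.span_base imageI)
    finally have "mfps_scale (inverse (c p)) (mfps_scale (c p) (star_prod p)) \<in> mfps.span ?T"
      by (rule mfps.span_scale)
    with cp show ?thesis by simp
  qed
  have "power_prod ` ?P \<subseteq> mfps.span ?T"
  proof
    fix f assume "f \<in> power_prod ` ?P"
    then obtain m where m: "m \<in> ?P" "f = power_prod m" by auto
    then obtain d where "f = (\<Sum>m\<in>?P. mfps_scale (d m) (star_prod m))"
      using star_lead_power_prod[of m] unfolding star_lead_def part_msets_def by auto
    also have "\<dots> \<in> mfps.span ?T"
    proof (intro mfps.span_sum mfps.span_scale)
      fix q assume "q \<in> ?P"
      then show "star_prod q \<in> mfps.span ?T"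
        using sp by (cases "q = p") (auto intro: mfps.span_base)
    qed
    finally show "f \<in> mfps.span ?T" .
  qed
  \<comment> \<open>As many independent elements as there are indices would lie in a span of fewer
    elements.\<close>
  then have "card (power_prod ` ?P) \<le> card ?T"
    using mfps.independent_span_bound[OF _ ind, of ?T] fin by simp
  also have "\<dots> \<le> card (?P - {p})" using fin by (simp add: card_image_le)
  also have "\<dots> < card ?P" using fin p by (intro psubset_card_mono) auto
  finally show False using inj by (simp add: card_image)
qed

text \<open>At the first difference a < b, the parts of xs from there on are at most a, since the
  parts decrease; hence b exceeds all of them and decides the multiset order, and the common initial
  parts cancel. A proper prefix would have a smaller sum.\<close>

lemma mset_less_if_partition_less:
  assumes "xs < ys" "ys \<in> partitions n"
  shows "xs \<notin> partitions n \<or> mset xs < mset ys"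
proof (cases "\<exists>a v. ys = xs @ a # v")
  case True
  then obtain a v where "ys = xs @ a # v" by blast
  with assms(2) show ?thesis by (auto simp: partitions_def)
next
  case False
  have "(\<exists>a v. ys = xs @ a # v) \<or> (\<exists>u a b v w. a < b \<and> xs = u @ a # v \<and> ys = u @ b # w)"
    using assms(1) by (simp add: list_less_def lexord_def)
  with False have "\<exists>u a b v w. a < b \<and> xs = u @ a # v \<and> ys = u @ b # w" by argo
  then obtain u a b v w where uv: "a < b" "xs = u @ a # v" "ys = u @ b # w"
    by (elim exE conjE) (rule that)
  show ?thesis
  proof (cases "xs \<in> partitions n")
    case True
    then have "\<forall>x \<in> set v. x \<le> a" by (simp add: partitions_def sorted_wrt_append uv(2))
    then have "x < b" if "x \<in># mset (a # v)" for x
      using that uv(1) by auto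
    moreover have "b \<in># mset (b # w)" by simp
    ultimately have "mset (a # v) < mset (b # w)" by (meson ex_gt_imp_less_multiset)
    then show ?thesis by (simp add: uv(2,3))
  qed simp
qed

text \<open>Independence of the star products evaluates the definite description in
  \<open>star_coeff\<close>; a nonzero a makes m an index that occurs, and all smaller ones are
  known to be absent.\<close>

lemma leading_coeff_eqI:
  assumes lead: "star_lead (card V) m a (chromatic_sf V E)" and m: "m \<in> part_msets (card V)" and a: "a \<noteq> 0"
  shows "leading_coeff V E = a"
proof -
  let ?n = "card V"
  obtain c where c: "chromatic_sf V E = (\<Sum>m\<in>part_msets ?n. mfps_scale (c m) (star_prod m))" "c m = a" "\<forall>m'<m. c m' = 0"
    using lead unfolding star_lead_def by blast
  have reindex: "(\<Sum>\<mu>\<in>partitions ?n. mfps_scale (d \<mu>) (star_part_sf \<mu>)) =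
      (\<Sum>m\<in>part_msets ?n. mfps_scale (d (inv_into (partitions ?n) mset m)) (star_prod m))" for d
  proof -
    let ?g = "\<lambda>m. mfps_scale (d (inv_into (partitions ?n) mset m)) (star_prod m)"
    have "(\<Sum>\<mu>\<in>partitions ?n. mfps_scale (d \<mu>) (star_part_sf \<mu>)) = (\<Sum>\<mu>\<in>partitions ?n. ?g (mset \<mu>))"
      by (intro sum.cong refl)
         (simp add: bij_betw_inv_into_left[OF bij_betw_partitions] star_part_sf_def star_prod_def
           flip: prod_mset_prod_list)
    also have "\<dots> = (\<Sum>m\<in>part_msets ?n. ?g m)"
      by (rule sum.reindex_bij_betw[OF bij_betw_partitions])
    finally show ?thesis .
  qed
  define c' where "c' = (\<lambda>\<mu>. if \<mu> \<in> partitions ?n then c (mset \<mu>) else 0)"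
  have star: "star_coeff V E = c'"
    unfolding star_coeff_def
  proof (rule the_equality)
    show "(\<forall>\<mu>. \<mu> \<notin> partitions ?n \<longrightarrow> c' \<mu> = 0) \<and>
      chromatic_sf V E = (\<Sum>\<mu>\<in>partitions ?n. mfps_scale (c' \<mu>) (star_part_sf \<mu>))"
      unfolding reindex c(1) c'_def
      by (auto intro!: sum.cong
          simp: bij_betw_inv_into_right[OF bij_betw_partitions] bij_betw_apply[OF bij_betw_inv_into[OF bij_betw_partitions]])
  next
    fix d assume d: "(\<forall>\<mu>. \<mu> \<notin> partitions ?n \<longrightarrow> d \<mu> = 0) \<and>
      chromatic_sf V E = (\<Sum>\<mu>\<in>partitions ?n. mfps_scale (d \<mu>) (star_part_sf \<mu>))"
    let ?e = "\<lambda>m. d (inv_into (partitions ?n) mset m) - c m"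
    have "(\<Sum>m\<in>part_msets ?n. mfps_scale (?e m) (star_prod m)) = 0"
      using d c(1) by (simp add: reindex mfps.scale_left_diff_distrib sum_subtractf)
    then have e: "?e m = 0" if "m \<in> part_msets ?n" for m
      using that by (rule star_prod_independent)
    show "d = c'"
    proof
      fix \<mu>
      show "d \<mu> = c' \<mu>"
      proof (cases "\<mu> \<in> partitions ?n")
        case True
        then show ?thesis using e[of "mset \<mu>"] bij_betw_apply[OF bij_betw_partitions True]
          by (simp add: c'_def bij_betw_inv_into_left[OF bij_betw_partitions])
      qed (use d in \<open>simp add: c'_def\<close>)
    qed
  qed
  obtain \<mu>0 where \<mu>0: "\<mu>0 \<in> partitions ?n" "mset \<mu>0 = m"
    using m bij_betw_imp_surj_on[OF bij_betw_partitions, of ?n] by (metis imageE)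
  have "leading_partition V E = \<mu>0"
    unfolding leading_partition_def star
  proof (rule Min_eqI)
    show "finite {\<mu> \<in> partitions ?n. c' \<mu> \<noteq> 0}" by (simp add: finite_partitions)
    show "\<mu>0 \<in> {\<mu> \<in> partitions ?n. c' \<mu> \<noteq> 0}" using \<mu>0 c(2) a by (simp add: c'_def)
    fix \<mu> assume "\<mu> \<in> {\<mu> \<in> partitions ?n. c' \<mu> \<noteq> 0}"
    then have \<mu>: "\<mu> \<in> partitions ?n" "c (mset \<mu>) \<noteq> 0" by (auto simp: c'_def)
    show "\<mu>0 \<le> \<mu>"
      using mset_less_if_partition_less[of \<mu> \<mu>0 ?n] \<mu> \<mu>0 c(3) by (meson not_less)
  qed
  then show ?thesis using \<mu>0 c(2) by (simp add: leading_coeff_def star c'_def)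
qed

section \<open>Expansion over edge sets\<close>

lemma prod_of_bool:
  "finite A \<Longrightarrow> (\<Prod>x\<in>A. of_bool (P x)) = (of_bool (\<forall>x\<in>A. P x) :: 'b::comm_semiring_1)"
  by (induction A rule: finite_induct) auto

section \<open>Components of an edge set\<close>

definition component :: "'a set set \<Rightarrow> 'a \<Rightarrow> 'a set" where
  "component S v = {u. (v, u) \<in> (adj_rel S)\<^sup>*}"

definition components :: "'a set \<Rightarrow> 'a set set \<Rightarrow> 'a set set" where
  "components V S = component S ` V"

lemma sym_adj_rel: "sym (adj_rel S)"
  by (auto simp: adj_rel_def insert_commute intro: symI)

lemma adj_rel_mono: "S \<subseteq> T \<Longrightarrow> adj_rel S \<subseteq> adj_rel T"
  by (auto simp: adj_rel_def)

lemma component_mono: "S \<subseteq> T \<Longrightarrow> component S v \<subseteq> component T v"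
  using rtrancl_mono[OF adj_rel_mono] by (auto simp: component_def)

lemma component_self [simp]: "v \<in> component S v"
  by (simp add: component_def)

lemma component_sym: "u \<in> component S v \<longleftrightarrow> v \<in> component S u"
proof -
  have "v \<in> component S u" if "u \<in> component S v" for u v
    using that symD[OF sym_rtrancl[OF sym_adj_rel], of v u S] by (simp add: component_def)
  then show ?thesis by blast
qed

lemma component_trans: "u \<in> component S v \<Longrightarrow> w \<in> component S u \<Longrightarrow> w \<in> component S v"
  unfolding component_def by auto

lemma component_eq: "u \<in> component S v \<Longrightarrow> component S u = component S v"
  using component_trans component_sym by (metis subsetI subset_antisym)

lemma component_disjoint: "component S u \<noteq> component S v \<Longrightarrow> component S u \<inter> component S v = {}"
  using component_eq[of _ S u] component_eq[of _ S v] by (metis disjoint_iff)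

lemma component_subset:
  assumes "\<And>e. e \<in> S \<Longrightarrow> e \<subseteq> V" "v \<in> V"
  shows "component S v \<subseteq> V"
proof
  fix u assume "u \<in> component S v"
  then have "(v, u) \<in> (adj_rel S)\<^sup>*" by (simp add: component_def)
  then show "u \<in> V"
    by (induction rule: rtrancl_induct) (use assms in \<open>auto simp: adj_rel_def\<close>)
qed

lemma component_isolated:
  assumes "\<And>e. e \<in> S \<Longrightarrow> v \<notin> e"
  shows "component S v = {v}"
proof -
  have "u = v" if "(v, u) \<in> (adj_rel S)\<^sup>*" for u
    using that by (induction rule: rtrancl_induct) (use assms in \<open>auto simp: adj_rel_def\<close>)
  then show ?thesis by (auto simp: component_def)
qed

lemma component_insert:
  "component (insert {x, y} S) v =
    (if v \<in> component S x \<union> component S y then component S x \<union> component S y else component S v)"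
proof -
  have adj: "adj_rel (insert {x, y} S) = insert (x, y) (insert (y, x) (adj_rel S))"
    by (auto simp: adj_rel_def doubleton_eq_iff)
  have "u \<in> component (insert {x, y} S) v \<longleftrightarrow>
     u \<in> component S v \<or> (x \<in> component S v \<and> u \<in> component S y) \<or> (y \<in> component S v \<and> u \<in> component S x)" for u
    unfolding component_def adj mem_Collect_eq rtrancl_insert
    by (auto intro: rtrancl_trans)
  moreover have "x \<in> component S v \<longleftrightarrow> v \<in> component S x" "y \<in> component S v \<longleftrightarrow> v \<in> component S y"
    by (rule component_sym)+
  moreover have "v \<in> component S x \<Longrightarrow> component S v = component S x" "v \<in> component S y \<Longrightarrow> component S v = component S y"
    by (rule component_eq, assumption)+
  ultimately show ?thesis by auto
qed

lemma Union_components: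
  assumes "\<And>e. e \<in> S \<Longrightarrow> e \<subseteq> V"
  shows "\<Union>(components V S) = V"
  using component_subset[OF assms] by (auto simp: components_def)

lemma components_disjoint:
  "B \<in> components V S \<Longrightarrow> B' \<in> components V S \<Longrightarrow> B \<noteq> B' \<Longrightarrow> B \<inter> B' = {}"
  unfolding components_def by (elim imageE) (simp add: component_disjoint)

lemma finite_components: "finite V \<Longrightarrow> finite (components V S)"
  by (simp add: components_def)

text \<open>This form also covers x and y in the same component: the class that is removed is then
  put back.\<close>

lemma components_insert_edge:
  assumes "x \<in> V" "y \<in> V"
  shows "components V (insert {x, y} S) = insert (component S x \<union> component S y) (components V S - {component S x, component S y})"
proof -
  have "component S v \<noteq> component S x \<and> component S v \<noteq> component S y \<longleftrightarrow> v \<notin> component S x \<union> component S y" for v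
    using component_eq[of v S x] component_eq[of v S y] component_self[of v S] by blast
  then have *: "component (insert {x, y} S) v = (if component S v \<noteq> component S x \<and> component S v \<noteq> component S y
      then component S v else component S x \<union> component S y)" for v
    unfolding component_insert by simp
  show ?thesis
  proof (intro equalityI subsetI)
    fix B assume "B \<in> components V (insert {x, y} S)"
    then obtain v where "v \<in> V" "B = component (insert {x, y} S) v" by (auto simp: components_def)
    then show "B \<in> insert (component S x \<union> component S y) (components V S - {component S x, component S y})"
      unfolding * by (simp add: components_def)
  next
    fix B assume "B \<in> insert (component S x \<union> component S y) (components V S - {component S x, component S y})"
    then consider "B = component S x \<union> component S y"
      | v where "v \<in> V" "B = component S v" "B \<noteq> component S x" "B \<noteq> component S y"
      unfolding components_def by blast
    then show "B \<in> components V (insert {x, y} S)"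
    proof cases
      case 1
      then have "B = component (insert {x, y} S) x" by (simp add: *)
      then show ?thesis using assms(1) by (simp add: components_def)
    next
      case 2
      then have "B = component (insert {x, y} S) v" by (simp add: *)
      then show ?thesis using 2 by (simp add: components_def)
    qed
  qed
qed

text \<open>Generic in the ring and in the block weight: with block series it gives the chromatic
  symmetric function, with rational weights its coefficient at the candidate partition. For power
  sums of the component sizes it is Stanley's power sum expansion.\<close>

definition edge_expansion :: "'a set \<Rightarrow> 'a set set \<Rightarrow> ('a set \<Rightarrow> 'b::comm_ring_1) \<Rightarrow> 'b" where
  "edge_expansion V E \<mu> = (\<Sum>S\<in>Pow E. (-1) ^ card S * (\<Prod>B\<in>components V S. \<mu> B))"

text \<open>Each edge set S avoiding e is paired with S plus e, which has the opposite sign; the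
  recursions below evaluate the differences one S at a time.\<close>

lemma edge_expansion_insert:
  assumes "finite E" "e \<notin> E"
  shows "edge_expansion V (insert e E) \<mu> =
    (\<Sum>S\<in>Pow E. (-1) ^ card S * ((\<Prod>B\<in>components V S. \<mu> B) - (\<Prod>B\<in>components V (insert e S). \<mu> B)))"
proof -
  let ?g = "\<lambda>S. (-1) ^ card S * (\<Prod>B\<in>components V S. \<mu> B)"
  have "edge_expansion V (insert e E) \<mu> = (\<Sum>S\<in>Pow E. ?g S) + (\<Sum>S\<in>insert e ` Pow E. ?g S)"
    unfolding edge_expansion_def Pow_insert using assms by (intro sum.union_disjoint) auto
  also have "(\<Sum>S\<in>insert e ` Pow E. ?g S) = (\<Sum>S\<in>Pow E. ?g (insert e S))"
    using assms by (subst sum.reindex) (auto intro!: inj_onI)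
  also have "\<dots> = (\<Sum>S\<in>Pow E. - ((-1) ^ card S * (\<Prod>B\<in>components V (insert e S). \<mu> B)))"
  proof (intro sum.cong refl)
    fix S assume "S \<in> Pow E"
    then have "card (insert e S) = Suc (card S)"
      using assms by (meson PowD card_insert_disjoint finite_subset subsetD)
    then show "?g (insert e S) = - ((-1) ^ card S * (\<Prod>B\<in>components V (insert e S). \<mu> B))" by simp
  qed
  finally show ?thesis
    by (simp add: edge_expansion_def algebra_simps sum_negf sum_subtractf)
qed

lemma chromatic_sf_expansion:
  fixes I L :: "'a set" and F :: "'a set set" and \<eta> :: "'a \<Rightarrow> 'a"
  assumes fin: "finite I" "finite L" and disj: "I \<inter> L = {}" and \<eta>: "\<And>v. v \<in> L \<Longrightarrow> \<eta> v \<in> I"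
    and F: "\<And>e. e \<in> F \<Longrightarrow> e \<subseteq> I \<and> card e = 2"
  shows "chromatic_sf (I \<union> L) (F \<union> {{v, \<eta> v} | v. v \<in> L}) =
    edge_expansion I F (\<lambda>B. block_sf B {v \<in> L. \<eta> v \<in> B})"
proof -
  let ?E = "F \<union> {{v, \<eta> v} | v. v \<in> L}"
  define mono where "mono = (\<lambda>\<kappa> :: 'a \<Rightarrow> nat. \<lambda>e. \<forall>u\<in>e. \<forall>v\<in>e. \<kappa> u = \<kappa> v)"
  define leafy where "leafy = (\<lambda>\<kappa> :: 'a \<Rightarrow> nat. \<forall>v\<in>L. \<kappa> v \<noteq> \<kappa> (\<eta> v))"
  have finF: "finite F"
    using F fin(1) by (intro finite_subset[of F "Pow I"]) auto
  \<comment> \<open>Inclusion-exclusion over F only, by multiplying out the factors 1 -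
    [e is monochromatic]; the conditions at the leaves remain as a common factor.\<close>
  have ind: "of_bool (\<forall>u v. {u, v} \<in> ?E \<longrightarrow> \<kappa> u \<noteq> \<kappa> v) =
      (\<Sum>S\<in>Pow F. (-1) ^ card S * of_bool ((\<forall>e\<in>S. mono \<kappa> e) \<and> leafy \<kappa>) :: rat)" for \<kappa>
  proof -
    have "(\<forall>u v. {u, v} \<in> F \<longrightarrow> \<kappa> u \<noteq> \<kappa> v) \<longleftrightarrow> (\<forall>e\<in>F. \<not> mono \<kappa> e)"
    proof (intro iffI ballI allI impI)
      fix e assume *: "\<forall>u v. {u, v} \<in> F \<longrightarrow> \<kappa> u \<noteq> \<kappa> v" "e \<in> F"
      then obtain u v where "e = {u, v}" using F by (meson card_2_iff)
      then show "\<not> mono \<kappa> e" using * by (auto simp: mono_def)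
    next
      fix u v assume "\<forall>e\<in>F. \<not> mono \<kappa> e" "{u, v} \<in> F"
      then have "\<not> mono \<kappa> {u, v}" by blast
      then show "\<kappa> u \<noteq> \<kappa> v" by (auto simp: mono_def)
    qed
    moreover have "(\<forall>u v. {u, v} \<in> {{v, \<eta> v} | v. v \<in> L} \<longrightarrow> \<kappa> u \<noteq> \<kappa> v) \<longleftrightarrow> leafy \<kappa>"
    proof (intro iffI allI impI)
      assume *: "\<forall>u v. {u, v} \<in> {{v, \<eta> v} | v. v \<in> L} \<longrightarrow> \<kappa> u \<noteq> \<kappa> v"
      have "{v, \<eta> v} \<in> {{v, \<eta> v} | v. v \<in> L}" if "v \<in> L" for v using that by blast
      with * show "leafy \<kappa>" unfolding leafy_def by blast
    next
      fix u v assume *: "leafy \<kappa>" "{u, v} \<in> {{v, \<eta> v} | v. v \<in> L}"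
      then obtain w where w: "w \<in> L" "u = w \<and> v = \<eta> w \<or> u = \<eta> w \<and> v = w"
        by (auto simp: doubleton_eq_iff)
      from *(1) w(1) have "\<kappa> w \<noteq> \<kappa> (\<eta> w)" by (simp add: leafy_def)
      with w(2) show "\<kappa> u \<noteq> \<kappa> v" by auto
    qed
    ultimately have "(\<forall>u v. {u, v} \<in> ?E \<longrightarrow> \<kappa> u \<noteq> \<kappa> v) \<longleftrightarrow> (\<forall>e\<in>F. \<not> mono \<kappa> e) \<and> leafy \<kappa>"
      by (simp only: Un_iff) blast
    then have "of_bool (\<forall>u v. {u, v} \<in> ?E \<longrightarrow> \<kappa> u \<noteq> \<kappa> v) =
        (of_bool (\<forall>e\<in>F. \<not> mono \<kappa> e) * of_bool (leafy \<kappa>) :: rat)"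
      by (simp only: of_bool_conj)
    also have "of_bool (\<forall>e\<in>F. \<not> mono \<kappa> e) = (\<Prod>e\<in>F. 1 - of_bool (mono \<kappa> e) :: rat)"
      using finF by (simp add: prod_of_bool flip: of_bool_not_iff)
    also have "\<dots> = (\<Sum>S\<in>Pow F. (-1) ^ card S * (\<Prod>e\<in>S. of_bool (mono \<kappa> e)))"
      by (simp add: prod_diff_conv_sum[OF finF])
    also have "\<dots> = (\<Sum>S\<in>Pow F. (-1) ^ card S * of_bool (\<forall>e\<in>S. mono \<kappa> e))"
    proof (intro sum.cong refl)
      fix S assume "S \<in> Pow F"
      then have "finite S" using finF finite_subset by blast
      then show "(-1) ^ card S * (\<Prod>e\<in>S. of_bool (mono \<kappa> e)) =
          (-1) ^ card S * (of_bool (\<forall>e\<in>S. mono \<kappa> e) :: rat)"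
        by (simp add: prod_of_bool)
    qed
    finally show ?thesis by (simp add: sum_distrib_right mult.assoc of_bool_conj)
  qed
  have part: "coloring_gf (I \<union> L) (\<lambda>\<kappa>. of_bool ((\<forall>e\<in>S. mono \<kappa> e) \<and> leafy \<kappa>)) =
      (\<Prod>B\<in>components I S. block_sf B {v \<in> L. \<eta> v \<in> B})" if S: "S \<in> Pow F" for S
  proof -
    have SI: "\<And>e. e \<in> S \<Longrightarrow> e \<subseteq> I" using S F by blast
    \<comment> \<open>A component together with the leaves attached to it; these sets partition I
      \<union> L.\<close>
    let ?U = "\<lambda>B. B \<union> {v \<in> L. \<eta> v \<in> B}"
    have BI: "B \<subseteq> I" if "B \<in> components I S" for B using that Union_components[OF SI] by blast
    have "(\<Prod>B\<in>components I S. block_sf B {v \<in> L. \<eta> v \<in> B}) =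
      coloring_gf (\<Union>B\<in>components I S. ?U B) (\<lambda>\<kappa>. \<Prod>B\<in>components I S.
        of_bool ((\<forall>u\<in>B. \<forall>v\<in>B. restrict \<kappa> (?U B) u = restrict \<kappa> (?U B) v) \<and>
          (\<forall>u\<in>B. \<forall>v\<in>{v \<in> L. \<eta> v \<in> B}. restrict \<kappa> (?U B) u \<noteq> restrict \<kappa> (?U B) v)))"
      unfolding block_sf_def
    proof (rule coloring_gf_prod)
      show "finite (components I S)" using fin by (simp add: finite_components)
      show "finite (?U B)" if "B \<in> components I S" for B
        using BI[OF that] fin by (auto intro: finite_subset)
      show "?U B \<inter> ?U B' = {}" if "B \<in> components I S" "B' \<in> components I S" "B \<noteq> B'" for B B'
        using components_disjoint[OF that] BI[OF that(1)] BI[OF that(2)] disj by blast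
    qed
    also have "(\<Union>B\<in>components I S. ?U B) = I \<union> L"
      using Union_components[OF SI] \<eta> by blast
    also have "coloring_gf (I \<union> L) (\<lambda>\<kappa>. \<Prod>B\<in>components I S.
        of_bool ((\<forall>u\<in>B. \<forall>v\<in>B. restrict \<kappa> (?U B) u = restrict \<kappa> (?U B) v) \<and>
          (\<forall>u\<in>B. \<forall>v\<in>{v \<in> L. \<eta> v \<in> B}. restrict \<kappa> (?U B) u \<noteq> restrict \<kappa> (?U B) v))) =
      coloring_gf (I \<union> L) (\<lambda>\<kappa>. of_bool ((\<forall>e\<in>S. mono \<kappa> e) \<and> leafy \<kappa>))"
    proof (rule coloring_gf_cong)
      fix \<kappa> :: "'a \<Rightarrow> nat"
      let ?Q = "\<lambda>B. (\<forall>u\<in>B. \<forall>v\<in>B. \<kappa> u = \<kappa> v) \<and> (\<forall>u\<in>B. \<forall>v\<in>{v \<in> L. \<eta> v \<in> B}. \<kappa> u \<noteq> \<kappa> v)"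
      have "(\<Prod>B\<in>components I S.
        of_bool ((\<forall>u\<in>B. \<forall>v\<in>B. restrict \<kappa> (?U B) u = restrict \<kappa> (?U B) v) \<and>
          (\<forall>u\<in>B. \<forall>v\<in>{v \<in> L. \<eta> v \<in> B}. restrict \<kappa> (?U B) u \<noteq> restrict \<kappa> (?U B) v))) =
         (\<Prod>B\<in>components I S. of_bool (?Q B) :: rat)"
        by (intro prod.cong refl arg_cong[where f = of_bool]) (simp cong: ball_cong)
      also have "\<dots> = of_bool (\<forall>B\<in>components I S. ?Q B)"
        by (rule prod_of_bool) (simp add: finite_components fin(1))
      \<comment> \<open>Monochromatic edges of S mean constant colour on components, and a leaf v
        then has to avoid the colour of the component of \<open>\<eta> v\<close>.\<close>
      also have "(\<forall>B\<in>components I S. ?Q B) \<longleftrightarrow> (\<forall>e\<in>S. mono \<kappa> e) \<and> leafy \<kappa>"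
      proof (intro iffI conjI ballI)
        fix e assume Q: "\<forall>B\<in>components I S. ?Q B" and e: "e \<in> S"
        have "card e = 2" using e S F by blast
        then obtain u v where uv: "e = {u, v}" by (meson card_2_iff)
        have "v \<in> component S u" using e uv by (auto simp: component_def adj_rel_def)
        moreover have "component S u \<in> components I S" using SI[OF e] uv by (auto simp: components_def)
        ultimately have "\<kappa> u = \<kappa> v" using Q component_self[of u S] by blast
        then show "mono \<kappa> e" by (auto simp: mono_def uv)
      next
        assume Q: "\<forall>B\<in>components I S. ?Q B"
        show "leafy \<kappa>" unfolding leafy_def
        proof
          fix v assume v: "v \<in> L"
          then have "component S (\<eta> v) \<in> components I S" using \<eta> by (auto simp: components_def)
          moreover have "\<eta> v \<in> component S (\<eta> v)" by simp
          ultimately have "\<kappa> (\<eta> v) \<noteq> \<kappa> v" using Q v by blast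
          then show "\<kappa> v \<noteq> \<kappa> (\<eta> v)" by simp
        qed
      next
        fix B u v
        assume *: "(\<forall>e\<in>S. mono \<kappa> e) \<and> leafy \<kappa>" and B: "B \<in> components I S"
        have const: "\<kappa> b = \<kappa> a" if "(a, b) \<in> (adj_rel S)\<^sup>*" for a b
          using that
        proof (induction rule: rtrancl_induct)
          case (step b c)
          then have "mono \<kappa> {b, c}" using * by (auto simp: adj_rel_def)
          then have "\<kappa> b = \<kappa> c" unfolding mono_def by blast
          with step.IH show ?case by simp
        qed simp
        then have cB: "\<kappa> a = \<kappa> b" if "a \<in> B" "b \<in> B" for a b
          using that B by (auto simp: components_def component_def)
        show "\<kappa> u = \<kappa> v" if "u \<in> B" "v \<in> B" using that by (rule cB)
        show "\<kappa> u \<noteq> \<kappa> v" if "u \<in> B" "v \<in> {v \<in> L. \<eta> v \<in> B}"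
        proof -
          have "\<kappa> u = \<kappa> (\<eta> v)" using that by (intro cB) auto
          moreover have "\<kappa> v \<noteq> \<kappa> (\<eta> v)" using * that by (auto simp: leafy_def)
          ultimately show ?thesis by simp
        qed
      qed
      finally show "(\<Prod>B\<in>components I S.
        of_bool ((\<forall>u\<in>B. \<forall>v\<in>B. restrict \<kappa> (?U B) u = restrict \<kappa> (?U B) v) \<and>
          (\<forall>u\<in>B. \<forall>v\<in>{v \<in> L. \<eta> v \<in> B}. restrict \<kappa> (?U B) u \<noteq> restrict \<kappa> (?U B) v))) =
        (of_bool ((\<forall>e\<in>S. mono \<kappa> e) \<and> leafy \<kappa>) :: rat)" .
    qed
    finally show ?thesis by simp
  qed
  have "chromatic_sf (I \<union> L) ?E = coloring_gf (I \<union> L)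
      (\<lambda>\<kappa>. \<Sum>S\<in>Pow F. (-1) ^ card S * of_bool ((\<forall>e\<in>S. mono \<kappa> e) \<and> leafy \<kappa>))"
    using fin by (subst chromatic_sf_eq_gf) (auto simp only: ind finite_Un)
  also have "\<dots> = (\<Sum>S\<in>Pow F. (-1) ^ card S *
      coloring_gf (I \<union> L) (\<lambda>\<kappa>. of_bool ((\<forall>e\<in>S. mono \<kappa> e) \<and> leafy \<kappa>)))"
    by (rule coloring_gf_sign_sum)
  also have "\<dots> = edge_expansion I F (\<lambda>B. block_sf B {v \<in> L. \<eta> v \<in> B})"
    unfolding edge_expansion_def by (intro sum.cong refl) (simp only: part)
  finally show ?thesis .
qed

section \<open>Weighted expansions of paths and cycles\<close>

text \<open>Over the dual numbers, $\prod_{v \in B} (f_v + m_v \varepsilon)$ has the \<open>\<epsilon>\<close>-coefficient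
  \<open>deriv_prod f m B\<close>; \<open>block_weight\<close> below adds up both coefficients.\<close>

definition deriv_prod :: "('a \<Rightarrow> 'b) \<Rightarrow> ('a \<Rightarrow> 'b) \<Rightarrow> 'a set \<Rightarrow> 'b::comm_ring_1" where
  "deriv_prod f m B = (\<Sum>v\<in>B. m v * (\<Prod>u\<in>B - {v}. f u))"

text \<open>Product rule for the factor f u + m u \<epsilon>.\<close>

lemma deriv_prod_insert:
  assumes "finite B" "u \<notin> B"
  shows "deriv_prod f m (insert u B) = m u * prod f B + f u * deriv_prod f m B"
proof -
  have "(\<Prod>w\<in>insert u B - {v}. f w) = f u * (\<Prod>w\<in>B - {v}. f w)" if "v \<in> B" for v
  proof -
    have "insert u B - {v} = insert u (B - {v})" using assms that by auto
    then show ?thesis using assms by simp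
  qed
  moreover have "insert u B - {u} = B" using assms by auto
  ultimately show ?thesis
    using assms by (simp add: deriv_prod_def sum_distrib_left mult.left_commute cong: sum.cong)
qed

lemma deriv_prod_union:
  assumes "finite A" "finite B" "A \<inter> B = {}"
  shows "deriv_prod f m (A \<union> B) = deriv_prod f m A * prod f B + prod f A * deriv_prod f m B"
  using assms
proof (induction A rule: finite_induct)
  case empty
  then show ?case by (simp add: deriv_prod_def)
next
  case (insert u A)
  then show ?case
    by (simp add: deriv_prod_insert prod.union_disjoint algebra_simps)
qed

lemma deriv_prod_cong:
  "(\<And>v. v \<in> B \<Longrightarrow> m v = m' v) \<Longrightarrow> deriv_prod f m B = deriv_prod f m' B"
  by (simp add: deriv_prod_def)

lemma deriv_prod_update:
  assumes "finite B" "v \<in> B"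
  shows "deriv_prod f (m(v := m v - f v)) B = deriv_prod f m B - prod f B"
proof -
  obtain A where A: "B = insert v A" "v \<notin> A" "finite A"
    using assms by (metis Set.set_insert finite_insert)
  have "deriv_prod f (m(v := m v - f v)) A = deriv_prod f m A"
    using A by (intro deriv_prod_cong) auto
  then show ?thesis using A by (simp add: deriv_prod_insert algebra_simps)
qed

definition block_weight :: "('a \<Rightarrow> 'b) \<Rightarrow> ('a \<Rightarrow> 'b) \<Rightarrow> 'a set \<Rightarrow> 'b::comm_ring_1" where
  "block_weight f m B = prod f B + deriv_prod f m B"

lemma block_weight_cong:
  "(\<And>v. v \<in> B \<Longrightarrow> m v = m' v) \<Longrightarrow> block_weight f m B = block_weight f m' B"
  using deriv_prod_cong[of B m m' f] by (simp add: block_weight_def)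

text \<open>The shift of one m v by f v removes exactly the constant coefficient from the weight.
  This is what allows a difference of two weighted expansions to be written as one weighted
  expansion.\<close>

lemma block_weight_update:
  "finite B \<Longrightarrow> v \<in> B \<Longrightarrow> block_weight f (m(v := m v - f v)) B = deriv_prod f m B"
  by (simp add: block_weight_def deriv_prod_update)

text \<open>For a fixed S let the component of v have the coefficients F + G \<epsilon>. Leaving u
  alone gives (f u + m u)(F + G), joining it gives f u F + m u F + f u G, and the difference is m u
  G. By \<open>block_weight_update\<close>, G is the weight of the same component after the shift at
  v.\<close>

lemma edge_expansion_pendant:
  assumes fin: "finite V" and E: "\<And>e. e \<in> E \<Longrightarrow> e \<subseteq> V" and v: "v \<in> V" and u: "u \<notin> V"
  shows "edge_expansion (insert u V) (insert {u, v} E) (block_weight f m) =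
    m u * edge_expansion V E (block_weight f (m(v := m v - f v)))"
proof -
  let ?m = "m(v := m v - f v)"
  have finE: "finite E" using fin E by (intro finite_subset[of E "Pow V"]) auto
  have notin: "{u, v} \<notin> E" using E u by auto
  have "(\<Prod>B\<in>components (insert u V) S. block_weight f m B) -
      (\<Prod>B\<in>components (insert u V) (insert {u, v} S). block_weight f m B) =
      m u * (\<Prod>B\<in>components V S. block_weight f ?m B)" if "S \<in> Pow E" for S
  proof -
    have SV: "\<And>e. e \<in> S \<Longrightarrow> e \<subseteq> V" using that E by blast
    have cu: "component S u = {u}" using SV u by (intro component_isolated) blast
    let ?B = "component S v"
    define P where "P = components V S - {?B}"
    have P: "finite P" "?B \<notin> P" "components V S = insert ?B P"
      using fin v by (auto simp: P_def components_def)
    have BV: "?B \<subseteq> V" using SV v by (rule component_subset)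
    have finB: "finite ?B" using BV fin by (rule finite_subset)
    have uB: "u \<notin> ?B" using BV u by auto
    have sub: "B \<subseteq> V" if "B \<in> P" for B using that P Union_components[OF SV] by blast
    have cV: "components (insert u V) S = insert {u} (insert ?B P)"
      using P(3) cu by (simp add: components_def)
    have uP: "{u} \<noteq> ?B" "{u} \<notin> P" using uB sub u by auto
    then have 1: "(\<Prod>B\<in>components (insert u V) S. block_weight f m B) =
        (f u + m u) * (block_weight f m ?B * (\<Prod>B\<in>P. block_weight f m B))"
      unfolding cV using P by (simp add: block_weight_def deriv_prod_def)
    have "components (insert u V) (insert {u, v} S) =
        insert (insert u ?B) (insert {u} (insert ?B P) - {{u}, ?B})"
      using v by (subst components_insert_edge) (auto simp: cu cV)
    also have "insert {u} (insert ?B P) - {{u}, ?B} = P" using uP P by auto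
    finally have "components (insert u V) (insert {u, v} S) = insert (insert u ?B) P" .
    moreover have "insert u ?B \<notin> P" using sub u by auto
    ultimately have 2: "(\<Prod>B\<in>components (insert u V) (insert {u, v} S). block_weight f m B) =
        block_weight f m (insert u ?B) * (\<Prod>B\<in>P. block_weight f m B)"
      using P by simp
    have "(\<Prod>B\<in>P. block_weight f ?m B) = (\<Prod>B\<in>P. block_weight f m B)"
    proof (intro prod.cong refl block_weight_cong)
      fix B w assume "B \<in> P" "w \<in> B"
      then have "w \<noteq> v" using component_eq[of v S] by (auto simp: P_def components_def)
      then show "?m w = m w" by simp
    qed
    then have 3: "(\<Prod>B\<in>components V S. block_weight f ?m B) =
        deriv_prod f m ?B * (\<Prod>B\<in>P. block_weight f m B)"
      unfolding P(3) using P finB by (simp add: block_weight_update)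
    show ?thesis unfolding 1 2 3 using finB uB
      by (simp add: block_weight_def deriv_prod_insert algebra_simps)
  qed
  note eq = this
  show ?thesis unfolding edge_expansion_insert[OF finE notin]
    unfolding edge_expansion_def sum_distrib_left
    by (intro sum.cong refl) (simp only: eq mult.left_commute)
qed

text \<open>If S leaves x and y in different components, separating minus joining them gives the
  product of the two \<epsilon>-coefficients, which the shifts at x and y produce. If S already
  joins them, the new edge changes no component and the true difference is 0, whereas both shifts
  then hit the same block; by the assumption on connectivity this happens for S = E only and is
  subtracted.\<close>

lemma edge_expansion_close:
  assumes fin: "finite V" and E: "\<And>e. e \<in> E \<Longrightarrow> e \<subseteq> V" and xy: "x \<in> V" "y \<in> V" "x \<noteq> y"
    and notin: "{x, y} \<notin> E"
    and conn: "\<And>S. S \<subseteq> E \<Longrightarrow> y \<in> component S x \<longleftrightarrow> S = E" and all: "component E x = V"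
  shows "edge_expansion V (insert {x, y} E) (block_weight f m) =
    edge_expansion V E (block_weight f (m(x := m x - f x, y := m y - f y)))
    - (-1) ^ card E * (deriv_prod f m V - prod f V)"
proof -
  let ?m = "m(x := m x - f x, y := m y - f y)"
  let ?P = "\<lambda>S m. \<Prod>B\<in>components V S. block_weight f m B"
  have finE: "finite E" using fin E by (intro finite_subset[of E "Pow V"]) auto
  have mm: "?m = (m(x := m x - f x))(y := (m(x := m x - f x)) y - f y)" using xy by auto
  have eq: "?P S m - ?P (insert {x, y} S) m =
      ?P S ?m - (if S = E then deriv_prod f m V - prod f V else 0)" if S: "S \<in> Pow E" for S
  proof (cases "S = E")
    case True
    have all': "component E w = V" if "w \<in> V" for w
      using component_eq[of w E x] all that by simp
    then have V: "components V E = {V}"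
      using xy(1) unfolding components_def by (metis image_cong image_constant)
    have "component E y = V" using xy(2) by (rule all')
    then have "components V (insert {x, y} E) = {V}"
      using xy all V by (simp add: components_insert_edge)
    moreover have "block_weight f ?m V = deriv_prod f m V - prod f V"
      unfolding mm using fin xy by (subst block_weight_update) (auto simp: deriv_prod_update)
    ultimately show ?thesis using True V by simp
  next
    case False
    have SV: "\<And>e. e \<in> S \<Longrightarrow> e \<subseteq> V" using S E by blast
    let ?X = "component S x" and ?Y = "component S y"
    define R where "R = components V S - {?X, ?Y}"
    have "y \<notin> ?X" using conn[of S] S False by auto
    then have XY: "?X \<noteq> ?Y" using component_self[of y S] by auto
    then have disj: "?X \<inter> ?Y = {}" by (rule component_disjoint)
    have "x \<notin> ?Y" using disj component_self[of x S] by blast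
    have fins: "finite ?X" "finite ?Y" using component_subset[OF SV] xy fin finite_subset by metis+
    have V: "components V S = insert ?X (insert ?Y R)" "?X \<notin> R" "?Y \<notin> R" using xy by (auto simp: components_def R_def)
    have finR: "finite R" using fin by (simp add: R_def finite_components)
    have split: "?P S m' = block_weight f m' ?X * (block_weight f m' ?Y * (\<Prod>B\<in>R. block_weight f m' B))" for m'
      unfolding V(1) using XY finR V(2,3) by simp
    have R_eq: "(\<Prod>B\<in>R. block_weight f ?m B) = (\<Prod>B\<in>R. block_weight f m B)"
    proof (intro prod.cong refl block_weight_cong)
      fix B w assume "B \<in> R" "w \<in> B"
      then have "w \<noteq> x" "w \<noteq> y"
        using component_eq[of x S] component_eq[of y S] by (auto simp: R_def components_def)
      then show "?m w = m w" by simp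
    qed
    have "?X \<union> ?Y \<notin> R"
    proof
      assume "?X \<union> ?Y \<in> R"
      then obtain w where "?X \<union> ?Y = component S w" by (auto simp: R_def components_def)
      then have "?X = component S w" "?Y = component S w"
        using component_eq[of x S w] component_eq[of y S w] component_self[of x S] component_self[of y S] by blast+
      with XY show False by simp
    qed
    then have P2: "?P (insert {x, y} S) m = block_weight f m (?X \<union> ?Y) * (\<Prod>B\<in>R. block_weight f m B)"
      using xy finR by (simp add: components_insert_edge flip: R_def)
    have "block_weight f ?m ?X = block_weight f (m(x := m x - f x)) ?X"
      using \<open>y \<notin> ?X\<close> by (intro block_weight_cong) auto
    also have "\<dots> = deriv_prod f m ?X" using fins by (simp add: block_weight_update)
    finally have bX: "block_weight f ?m ?X = deriv_prod f m ?X" .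
    have "block_weight f ?m ?Y = block_weight f (m(y := m y - f y)) ?Y"
      using \<open>x \<notin> ?Y\<close> by (intro block_weight_cong) auto
    also have "\<dots> = deriv_prod f m ?Y" using fins by (simp add: block_weight_update)
    finally have bY: "block_weight f ?m ?Y = deriv_prod f m ?Y" .
    show ?thesis unfolding split P2 R_eq bX bY using False fins disj
      by (simp add: block_weight_def deriv_prod_union prod.union_disjoint algebra_simps)
  qed
  have "edge_expansion V (insert {x, y} E) (block_weight f m) =
     (\<Sum>S\<in>Pow E. (-1) ^ card S * (?P S ?m - (if S = E then deriv_prod f m V - prod f V else 0)))"
    unfolding edge_expansion_insert[OF finE notin] by (intro sum.cong refl) (simp only: eq)
  also have "\<dots> = edge_expansion V E (block_weight f ?m) -
      (\<Sum>S\<in>Pow E. if S = E then (-1) ^ card E * (deriv_prod f m V - prod f V) else 0)"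
    unfolding edge_expansion_def sum_subtractf[symmetric] by (intro sum.cong refl) (simp add: algebra_simps)
  also have "(\<Sum>S\<in>Pow E. if S = E then (-1) ^ card E * (deriv_prod f m V - prod f V) else 0) =
      (-1) ^ card E * (deriv_prod f m V - prod f V)"
    using finE by simp
  finally show ?thesis .
qed

section \<open>Paths and cycles as edge sets\<close>

fun path_edges :: "'a list \<Rightarrow> 'a set set" where
  "path_edges (a # b # xs) = insert {a, b} (path_edges (b # xs))"
| "path_edges _ = {}"

lemma path_edges_subset: "e \<in> path_edges vs \<Longrightarrow> e \<subseteq> set vs"
  by (induction vs rule: path_edges.induct) auto

lemma finite_path_edges: "finite (path_edges vs)"
  by (induction vs rule: path_edges.induct) auto

lemma path_edges_nth: "path_edges vs = {{vs ! i, vs ! Suc i} | i. Suc i < length vs}"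
proof (induction vs rule: path_edges.induct)
  case (1 a b xs)
  show ?case unfolding path_edges.simps 1
  proof (intro equalityI subsetI)
    fix e assume "e \<in> insert {a, b} {{(b # xs) ! i, (b # xs) ! Suc i} | i. Suc i < length (b # xs)}"
    then consider "e = {a, b}" | i where "e = {(b # xs) ! i, (b # xs) ! Suc i}" "Suc i < length (b # xs)" by blast
    then show "e \<in> {{(a # b # xs) ! i, (a # b # xs) ! Suc i} | i. Suc i < length (a # b # xs)}"
    proof cases
      case 1
      then show ?thesis by (intro CollectI exI[of _ 0]) simp
    next
      case (2 i)
      then show ?thesis by (intro CollectI exI[of _ "Suc i"]) simp
    qed
  next
    fix e assume "e \<in> {{(a # b # xs) ! i, (a # b # xs) ! Suc i} | i. Suc i < length (a # b # xs)}"
    then obtain i where i: "e = {(a # b # xs) ! i, (a # b # xs) ! Suc i}" "Suc i < length (a # b # xs)" by blast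
    then show "e \<in> insert {a, b} {{(b # xs) ! i, (b # xs) ! Suc i} | i. Suc i < length (b # xs)}"
      by (cases i) auto
  qed
qed auto

lemma cycle_edges_path:
  assumes "length vs \<ge> 1"
  shows "cycle_edges vs = insert {hd vs, last vs} (path_edges vs)"
proof -
  let ?n = "length vs"
  have hl: "hd vs = vs ! 0" "last vs = vs ! (?n - 1)"
    using assms by (cases vs; simp add: last_conv_nth)+
  have "e \<in> cycle_edges vs \<longleftrightarrow> e = {hd vs, last vs} \<or> (\<exists>i. e = {vs ! i, vs ! Suc i} \<and> Suc i < ?n)" for e
  proof
    assume "e \<in> cycle_edges vs"
    then obtain i where i: "e = {vs ! i, vs ! (Suc i mod ?n)}" "i < ?n" by (auto simp: cycle_edges_def)
    show "e = {hd vs, last vs} \<or> (\<exists>i. e = {vs ! i, vs ! Suc i} \<and> Suc i < ?n)"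
    proof (cases "Suc i < ?n")
      case False
      then have "Suc i = ?n" using i by simp
      then have "e = {vs ! (?n - 1), vs ! 0}" using i by (metis diff_Suc_1 mod_self)
      then show ?thesis using hl by (simp add: insert_commute)
    qed (use i in auto)
  next
    assume "e = {hd vs, last vs} \<or> (\<exists>i. e = {vs ! i, vs ! Suc i} \<and> Suc i < ?n)"
    then show "e \<in> cycle_edges vs"
    proof
      assume "e = {hd vs, last vs}"
      moreover have "Suc (?n - 1) = ?n" using assms by simp
      ultimately have "e = {vs ! (?n - 1), vs ! (Suc (?n - 1) mod ?n)}"
        using hl by (simp only: mod_self insert_commute)
      then show ?thesis unfolding cycle_edges_def using assms by (intro CollectI exI[of _ "?n - 1"]) simp
    next
      assume "\<exists>i. e = {vs ! i, vs ! Suc i} \<and> Suc i < ?n"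
      then obtain i where "e = {vs ! i, vs ! Suc i}" "Suc i < ?n" by blast
      then show ?thesis unfolding cycle_edges_def by (intro CollectI exI[of _ i]) simp
    qed
  qed
  then show ?thesis unfolding path_edges_nth by blast
qed

text \<open>Every edge of a path is a bridge between its ends. This is the connectivity assumption
  of \<open>edge_expansion_close\<close>.\<close>

lemma path_connected_iff:
  assumes "distinct vs" "vs \<noteq> []" "S \<subseteq> path_edges vs"
  shows "last vs \<in> component S (hd vs) \<longleftrightarrow> S = path_edges vs"
  using assms
proof (induction vs arbitrary: S rule: path_edges.induct)
  case (1 a b xs)
  let ?P = "path_edges (b # xs)"
  define S' where "S' = S - {{a, b}}"
  have S': "S' \<subseteq> ?P" using 1 by (auto simp: S'_def)
  have iso: "component S' a = {a}"
    using S' path_edges_subset[of _ "b # xs"] "1.prems"(1) by (intro component_isolated) fastforce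
  have "{a, b} \<notin> ?P" using path_edges_subset[of "{a, b}" "b # xs"] "1.prems"(1) by auto
  then have S'P: "S = path_edges (a # b # xs) \<longleftrightarrow> {a, b} \<in> S \<and> S' = ?P"
    using 1 by (auto simp: S'_def)
  have IH: "last (b # xs) \<in> component S' b \<longleftrightarrow> S' = ?P" using 1 S' by simp
  have la: "last (b # xs) \<noteq> a" using "1.prems"(1) by (metis distinct.simps(2) last_in_set list.distinct(1))
  show ?case
  proof (cases "{a, b} \<in> S")
    case True
    then have "S = insert {a, b} S'" by (auto simp: S'_def)
    then have "component S a = {a} \<union> component S' b" by (simp add: component_insert iso)
    then show ?thesis using IH la S'P True by simp
  next
    case False
    then have "S = S'" by (auto simp: S'_def)
    then show ?thesis using iso la S'P False by auto
  qed
qed auto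

lemma component_path:
  "distinct vs \<Longrightarrow> vs \<noteq> [] \<Longrightarrow> component (path_edges vs) (hd vs) = set vs"
proof (induction vs rule: path_edges.induct)
  case (1 a b xs)
  have "component (path_edges (b # xs)) a = {a}"
    using path_edges_subset[of _ "b # xs"] "1.prems"(1) by (intro component_isolated) fastforce
  then show ?case using 1 by (auto simp: component_insert)
next
  case ("2_2" v)
  show ?case using component_isolated[of "{}" v] by simp
qed simp

lemma card_path_edges: "distinct vs \<Longrightarrow> card (path_edges vs) = length vs - 1"
proof (induction vs rule: path_edges.induct)
  case (1 a b xs)
  have "{a, b} \<notin> path_edges (b # xs)" using path_edges_subset[of "{a, b}" "b # xs"] "1.prems" by auto
  then show ?case using 1 by (simp add: finite_path_edges)
qed auto

lemma vdegree_insert: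
  assumes "finite E" "e \<notin> E"
  shows "vdegree (insert e E) v = vdegree E v + of_bool (v \<in> e)"
proof -
  have "{e' \<in> insert e E. v \<in> e'} = (if v \<in> e then insert e {e' \<in> E. v \<in> e'} else {e' \<in> E. v \<in> e'})" by auto
  then show ?thesis using assms by (simp add: vdegree_def)
qed

lemma vdegree_notin: "(\<And>e. e \<in> E \<Longrightarrow> v \<notin> e) \<Longrightarrow> vdegree E v = 0"
  unfolding vdegree_def by (metis (no_types, lifting) card.empty empty_Collect_eq)

text \<open>Each end makes up for one missing neighbour; the only vertex of a trivial path is both
  ends and makes up for two.\<close>

lemma vdegree_path:
  "distinct vs \<Longrightarrow> v \<in> set vs \<Longrightarrow>
    vdegree (path_edges vs) v + of_bool (v = hd vs) + of_bool (v = last vs) = 2"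
proof (induction vs rule: path_edges.induct)
  case (1 a b xs)
  have notin: "{a, b} \<notin> path_edges (b # xs)" using path_edges_subset[of "{a, b}" "b # xs"] "1.prems" by auto
  have la: "last (b # xs) \<noteq> a" using "1.prems"(1) by (metis distinct.simps(2) last_in_set list.distinct(1))
  show ?case
  proof (cases "v = a")
    case True
    have "vdegree (path_edges (b # xs)) a = 0"
      using path_edges_subset[of _ "b # xs"] "1.prems"(1) by (intro vdegree_notin) fastforce
    then show ?thesis using True la notin by (auto simp: vdegree_insert finite_path_edges)
  next
    case False
    then show ?thesis using 1 notin by (auto simp: vdegree_insert finite_path_edges)
  qed
qed (auto simp: vdegree_def)

text \<open>The head is pendant at its successor, so vertices are removed from the front. An inner
  vertex has been shifted once when it is removed, the first one not at all.\<close>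

lemma edge_expansion_path:
  fixes f m :: "'a \<Rightarrow> 'b::comm_ring_1"
  assumes "distinct (a # xs)" "xs \<noteq> []"
  shows "edge_expansion (set (a # xs)) (path_edges (a # xs)) (block_weight f m) =
    m a * (\<Prod>v\<in>set (butlast xs). m v - f v) * m (last xs)"
  using assms
proof (induction xs arbitrary: a m)
  case (Cons b xs)
  have "edge_expansion (set (a # b # xs)) (path_edges (a # b # xs)) (block_weight f m) =
     m a * edge_expansion (set (b # xs)) (path_edges (b # xs)) (block_weight f (m(b := m b - f b)))"
    using Cons.prems path_edges_subset[of _ "b # xs"]
      edge_expansion_pendant[of "set (b # xs)" "path_edges (b # xs)" b a f m] by simp
  also have "edge_expansion (set (b # xs)) (path_edges (b # xs)) (block_weight f (m(b := m b - f b))) =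
     (\<Prod>v\<in>set (butlast (b # xs)). m v - f v) * m (last (b # xs))"
  \<comment> \<open>The last vertex left has weight f + (m - f) = m, so its shift
    disappears.\<close>
  proof (cases "xs = []")
    case True
    moreover have "component {} b = {b}" by (rule component_isolated) simp
    ultimately show ?thesis
      by (simp add: edge_expansion_def components_def block_weight_def deriv_prod_def)
  next
    case False
    let ?m = "m(b := m b - f b)"
    have "edge_expansion (set (b # xs)) (path_edges (b # xs)) (block_weight f ?m) =
      ?m b * (\<Prod>v\<in>set (butlast xs). ?m v - f v) * ?m (last xs)"
      using Cons.prems False by (intro Cons.IH) auto
    moreover have "b \<notin> set (butlast xs)" "last xs \<noteq> b"
      using Cons.prems False by (auto dest: in_set_butlastD)
    moreover from this have "(\<Prod>v\<in>set (butlast xs). ?m v - f v) = (\<Prod>v\<in>set (butlast xs). m v - f v)"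
      by (intro prod.cong) auto
    ultimately show ?thesis using False by simp
  qed
  finally show ?case by (simp add: mult.assoc)
qed simp

text \<open>The closing edge alone connects the ends, so by \<open>path_connected_iff\<close> it
  would be the whole path, which has at least two edges.\<close>

lemma closing_edge_notin_path:
  assumes "distinct vs" "length vs \<ge> 3"
  shows "{hd vs, last vs} \<notin> path_edges vs"
proof
  assume *: "{hd vs, last vs} \<in> path_edges vs"
  let ?S = "{{hd vs, last vs}}"
  have "last vs \<in> component ?S (hd vs)" by (auto simp: component_def adj_rel_def)
  moreover have "vs \<noteq> []" using assms by auto
  ultimately have "?S = path_edges vs"
    using path_connected_iff[of vs ?S] * assms by auto
  then have "card (path_edges vs) = 1" by (metis is_singletonI is_singleton_altdef)
  then show False using card_path_edges[OF assms(1)] assms(2) by simp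
qed

lemma hd_neq_last:
  assumes "distinct vs" "length vs \<ge> 2"
  shows "hd vs \<noteq> last vs"
  using assms by (cases vs) (auto split: if_splits)

lemma vdegree_cycle:
  assumes "distinct vs" "length vs \<ge> 3" "v \<in> set vs"
  shows "vdegree (cycle_edges vs) v = 2"
proof -
  have "length vs \<ge> 1" using assms by simp
  then have "vdegree (cycle_edges vs) v = vdegree (path_edges vs) v + of_bool (v \<in> {hd vs, last vs})"
    using assms by (simp add: cycle_edges_path vdegree_insert finite_path_edges closing_edge_notin_path)
  then show ?thesis
    using vdegree_path[OF assms(1,3)] hd_neq_last[of vs] assms by (auto split: if_splits)
qed

lemma card_cycle_edges:
  assumes "distinct vs" "length vs \<ge> 3"
  shows "card (cycle_edges vs) = length vs"
  using assms
  by (subst cycle_edges_path) (auto simp: finite_path_edges closing_edge_notin_path card_path_edges)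

lemma Union_cycle_edges: "\<Union>(cycle_edges vs) = set vs"
proof (intro equalityI subsetI)
  fix v assume "v \<in> \<Union>(cycle_edges vs)"
  then obtain i where "i < length vs" "v \<in> {vs ! i, vs ! (Suc i mod length vs)}"
    unfolding cycle_edges_def by blast
  moreover from this have "Suc i mod length vs < length vs" by (intro mod_less_divisor) linarith
  ultimately show "v \<in> set vs" by auto
next
  fix v assume "v \<in> set vs"
  then obtain i where "i < length vs" "v = vs ! i" by (metis in_set_conv_nth)
  then show "v \<in> \<Union>(cycle_edges vs)" unfolding cycle_edges_def by blast
qed

text \<open>Opening the cycle shifts the two ends of the remaining path once, so that all vertices
  contribute m - f alike. The path has one edge fewer than the cycle, which turns the subtracted
  term into one with sign (-1)^c, where c is the length.\<close>

lemma edge_expansion_cycle: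
  fixes f m :: "'a \<Rightarrow> 'b::comm_ring_1"
  assumes "distinct vs" "length vs \<ge> 3"
  shows "edge_expansion (set vs) (cycle_edges vs) (block_weight f m) =
    (\<Prod>v\<in>set vs. m v - f v) + (-1) ^ length vs * (deriv_prod f m (set vs) - prod f (set vs))"
proof -
  obtain a xs where vs: "vs = a # xs" using assms by (cases vs) auto
  have xs: "xs \<noteq> []" "length xs \<ge> 2" using assms vs by auto
  have len: "length vs \<ge> 1" using assms by simp
  let ?x = "hd vs" and ?y = "last vs"
  let ?m = "m(?x := m ?x - f ?x, ?y := m ?y - f ?y)"
  have ay: "a \<noteq> last xs" using assms(1) xs vs by auto
  obtain ys y where ys: "xs = ys @ [y]" using xs(1) by (metis append_butlast_last_id)
  then have dl: "last xs \<notin> set (butlast xs)" "set xs = insert (last xs) (set (butlast xs))" "a \<notin> set (butlast xs)"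
    using assms(1) vs by auto
  have notin: "{?x, ?y} \<notin> path_edges vs" using assms by (rule closing_edge_notin_path)
  have "edge_expansion (set vs) (cycle_edges vs) (block_weight f m) =
    edge_expansion (set vs) (path_edges vs) (block_weight f ?m)
      - (-1) ^ card (path_edges vs) * (deriv_prod f m (set vs) - prod f (set vs))"
    unfolding cycle_edges_path[OF len]
  proof (rule edge_expansion_close)
    show "hd vs \<noteq> last vs" "hd vs \<in> set vs" "last vs \<in> set vs" using vs xs ay by auto
    show "component (path_edges vs) (hd vs) = set vs" using assms vs by (intro component_path) auto
    show "last vs \<in> component S (hd vs) \<longleftrightarrow> S = path_edges vs" if "S \<subseteq> path_edges vs" for S
      using assms vs that by (intro path_connected_iff) auto
  qed (use notin path_edges_subset in blast)+
  also have "edge_expansion (set vs) (path_edges vs) (block_weight f ?m) =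
      ?m a * (\<Prod>v\<in>set (butlast xs). ?m v - f v) * ?m (last xs)"
    unfolding vs using assms(1) vs xs by (intro edge_expansion_path) auto
  also have "(\<Prod>v\<in>set (butlast xs). ?m v - f v) = (\<Prod>v\<in>set (butlast xs). m v - f v)"
    using dl vs xs by (intro prod.cong refl) auto
  also have "?m a * (\<Prod>v\<in>set (butlast xs). m v - f v) * ?m (last xs) = (\<Prod>v\<in>set vs. m v - f v)"
    using dl vs xs ay by (simp add: mult_ac)
  finally show ?thesis
    using card_path_edges[OF assms(1)] vs by (simp add: algebra_simps)
qed

section \<open>Unicyclic graphs\<close>

text \<open>Reverses the pruning of pendant vertices, so that rule induction matches
  \<open>edge_expansion_pendant\<close>.\<close>

inductive pendant_ext :: "'a set \<Rightarrow> 'a set set \<Rightarrow> 'a set \<Rightarrow> 'a set set \<Rightarrow> bool" for V0 E0 where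
  base: "pendant_ext V0 E0 V0 E0"
| step: "pendant_ext V0 E0 V E \<Longrightarrow> v \<in> V \<Longrightarrow> u \<notin> V \<Longrightarrow> pendant_ext V0 E0 (insert u V) (insert {u, v} E)"

lemma pendant_ext_finite:
  assumes "pendant_ext V0 E0 V E" "finite V0" "\<And>e. e \<in> E0 \<Longrightarrow> e \<subseteq> V0"
  shows "finite V \<and> V0 \<subseteq> V \<and> E0 \<subseteq> E \<and> (\<forall>e\<in>E. e \<subseteq> V)"
  using assms(1) by induction (use assms(2,3) in auto)

lemma pendant_ext_component:
  assumes "pendant_ext V0 E0 V E" "finite V0" "\<And>e. e \<in> E0 \<Longrightarrow> e \<subseteq> V0" "x \<in> V0" "component E0 x = V0"
  shows "component E x = V"
  using assms(1)
proof induction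
  case (step V E v u)
  have "\<forall>e\<in>E. e \<subseteq> V" using pendant_ext_finite[OF step.hyps(1) assms(2,3)] by blast
  then have "component E u = {u}" using step.hyps by (intro component_isolated) blast
  moreover have "component E v = V" using component_eq[of v E x] step by simp
  moreover have "x \<in> V" using pendant_ext_finite[OF step.hyps(1) assms(2,3)] assms(4) by blast
  ultimately show ?case by (simp add: component_insert)
qed (rule assms(5))

text \<open>A vertex of degree d off the cycle is shifted by each of its d - 1 later neighbours
  before it is removed itself. A cycle vertex is shifted by its d - 2 neighbours off the cycle;
  opening the cycle shifts it once more in the main product, but not in the term for the whole
  cycle. Hence d - 1 in the products and d - 2 in the derivative.\<close>

lemma edge_expansion_unicyclic:
  fixes f m :: "'a \<Rightarrow> 'b::comm_ring_1" and vs :: "'a list"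
  assumes vs: "distinct vs" "length vs \<ge> 3" and ext: "pendant_ext (set vs) (cycle_edges vs) V E"
  shows "edge_expansion V E (block_weight f m) =
    (\<Prod>v\<in>V - set vs. m v - (of_nat (vdegree E v) - 1) * f v) *
    ((\<Prod>v\<in>set vs. m v - (of_nat (vdegree E v) - 1) * f v) +
     (-1) ^ length vs * (deriv_prod f (\<lambda>v. m v - (of_nat (vdegree E v) - 2) * f v) (set vs) - prod f (set vs)))"
  using ext
proof (induction arbitrary: m)
  case base
  have "(\<Prod>v\<in>set vs. m v - (of_nat (vdegree (cycle_edges vs) v) - 1) * f v) = (\<Prod>v\<in>set vs. m v - f v)"
    by (intro prod.cong refl) (simp add: vdegree_cycle[OF vs])
  moreover have "deriv_prod f (\<lambda>v. m v - (of_nat (vdegree (cycle_edges vs) v) - 2) * f v) (set vs) =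
      deriv_prod f m (set vs)"
    by (rule deriv_prod_cong) (simp add: vdegree_cycle[OF vs])
  ultimately show ?case by (simp add: edge_expansion_cycle[OF vs])
next
  case (step V E v u)
  have sub: "\<And>e. e \<in> cycle_edges vs \<Longrightarrow> e \<subseteq> set vs" using Union_cycle_edges[of vs] by blast
  have fin: "finite V" "set vs \<subseteq> V" "\<And>e. e \<in> E \<Longrightarrow> e \<subseteq> V"
    using pendant_ext_finite[OF step.hyps(1) _ sub] by auto
  have finE: "finite E" using fin by (intro finite_subset[of E "Pow V"]) auto
  have notin: "{u, v} \<notin> E" using fin(3) step.hyps by auto
  let ?m = "m(v := m v - f v)"
  let ?E = "insert {u, v} E"
  have deg: "vdegree ?E w = vdegree E w + of_bool (w = v)" if "w \<in> V" for w
    using that step.hyps by (auto simp: vdegree_insert[OF finE notin])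
  \<comment> \<open>The new vertex has degree 1, so its factor is the unshifted m u.\<close>
  have "vdegree E u = 0" using fin(3) step.hyps by (intro vdegree_notin) blast
  then have degu: "vdegree ?E u = 1" by (simp add: vdegree_insert[OF finE notin])
  have z: "?m w - (of_nat (vdegree E w) - k) * f w = m w - (of_nat (vdegree ?E w) - k) * f w" if "w \<in> V" for w k
    using deg[OF that] by (simp add: algebra_simps)
  have "edge_expansion (insert u V) ?E (block_weight f m) = m u * edge_expansion V E (block_weight f ?m)"
    using fin step.hyps by (intro edge_expansion_pendant) auto
  also have "edge_expansion V E (block_weight f ?m) =
    (\<Prod>w\<in>V - set vs. ?m w - (of_nat (vdegree E w) - 1) * f w) *
    ((\<Prod>w\<in>set vs. ?m w - (of_nat (vdegree E w) - 1) * f w) +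
     (-1) ^ length vs * (deriv_prod f (\<lambda>w. ?m w - (of_nat (vdegree E w) - 2) * f w) (set vs) - prod f (set vs)))"
    by (rule step.IH)
  also have "(\<Prod>w\<in>V - set vs. ?m w - (of_nat (vdegree E w) - 1) * f w) =
      (\<Prod>w\<in>V - set vs. m w - (of_nat (vdegree ?E w) - 1) * f w)"
    by (intro prod.cong refl z) auto
  also have "(\<Prod>w\<in>set vs. ?m w - (of_nat (vdegree E w) - 1) * f w) =
      (\<Prod>w\<in>set vs. m w - (of_nat (vdegree ?E w) - 1) * f w)"
    using fin by (intro prod.cong refl z) auto
  also have "deriv_prod f (\<lambda>w. ?m w - (of_nat (vdegree E w) - 2) * f w) (set vs) =
      deriv_prod f (\<lambda>w. m w - (of_nat (vdegree ?E w) - 2) * f w) (set vs)"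
    using fin by (intro deriv_prod_cong z) auto
  also have "m u * ((\<Prod>w\<in>V - set vs. m w - (of_nat (vdegree ?E w) - 1) * f w) * X) =
      (\<Prod>w\<in>insert u V - set vs. m w - (of_nat (vdegree ?E w) - 1) * f w) * X" for X
  proof -
    have "insert u V - set vs = insert u (V - set vs)" "u \<notin> V - set vs" using step.hyps fin by auto
    then show ?thesis using fin(1) degu by (simp add: mult.assoc)
  qed
  finally show ?case .
qed

lemma path_edges_append: "path_edges (x # bs) \<subseteq> path_edges (as @ x # bs)"
proof (induction as)
  case (Cons a as)
  then show ?case by (cases as) auto
qed simp

lemma path_exists:
  assumes "(x, y) \<in> (adj_rel F)\<^sup>*"
  shows "\<exists>ps. ps \<noteq> [] \<and> distinct ps \<and> hd ps = x \<and> last ps = y \<and> path_edges ps \<subseteq> F"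
  using assms
proof (induction rule: converse_rtrancl_induct)
  case base
  show ?case by (rule exI[of _ "[y]"]) simp
next
  case (step x z)
  then obtain ps where ps: "ps \<noteq> []" "distinct ps" "hd ps = z" "last ps = y" "path_edges ps \<subseteq> F" by blast
  show ?case
  proof (cases "x \<in> set ps")
    case True
    then obtain as bs where split: "ps = as @ x # bs" by (meson split_list)
    have "path_edges (x # bs) \<subseteq> F"
      using path_edges_append[of x bs as] ps(5) unfolding split by (rule subset_trans)
    then show ?thesis using ps split by (intro exI[of _ "x # bs"]) auto
  next
    case False
    obtain qs where "ps = z # qs" using ps(1,3) by (cases ps) auto
    then have "path_edges (x # ps) \<subseteq> F" using ps(5) step.hyps(1) by (simp add: adj_rel_def)
    then show ?thesis using ps False by (intro exI[of _ "x # ps"]) auto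
  qed
qed

lemma rtrancl_leaves_set:
  assumes "(a, b) \<in> R\<^sup>*" "a \<in> W" "b \<notin> W"
  shows "\<exists>x y. (x, y) \<in> R \<and> x \<in> W \<and> y \<notin> W"
  using assms by (induction rule: rtrancl_induct) blast+

text \<open>A maximal subgraph grown from the cycle by pendant vertices spans the graph by connectivity,
  and an edge outside it would close a second cycle.\<close>

lemma unicyclic_pendant_ext:
  assumes G: "simple_graph V E" and conn: "connected_graph V E"
    and vs: "distinct vs" "length vs \<ge> 3" "cycle_edges vs \<subseteq> E"
    and uniq: "\<And>C. C \<in> cycles E \<Longrightarrow> C = cycle_edges vs"
  shows "pendant_ext (set vs) (cycle_edges vs) V E"
proof -
  let ?C = "cycle_edges vs"
  have E: "e \<subseteq> V" "card e = 2" if "e \<in> E" for e using G that by (auto simp: simple_graph_def)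
  have fin: "finite V" using G by (simp add: simple_graph_def)
  have subC: "\<And>e. e \<in> ?C \<Longrightarrow> e \<subseteq> set vs" using Union_cycle_edges[of vs] by blast
  have CV: "set vs \<subseteq> V" using Union_cycle_edges[of vs] vs(3) E by blast
  define P where "P = (\<lambda>(W, F). pendant_ext (set vs) ?C W F \<and> W \<subseteq> V \<and> F \<subseteq> E)"
  have P0: "P (set vs, ?C)" using vs CV by (simp add: P_def pendant_ext.base)
  have bound: "\<forall>y. P y \<longrightarrow> (card \<circ> fst) y < Suc (card V)"
    using fin by (auto simp: P_def less_Suc_eq_le intro: card_mono)
  obtain WF where "P WF" and max: "\<And>y. P y \<Longrightarrow> (card \<circ> fst) y \<le> (card \<circ> fst) WF"
    using ex_has_greatest_nat[OF P0 bound] by metis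
  then obtain W F where WF: "WF = (W, F)" and P: "pendant_ext (set vs) ?C W F" "W \<subseteq> V" "F \<subseteq> E"
    by (cases WF) (auto simp: P_def)
  have W: "finite W" "set vs \<subseteq> W" "?C \<subseteq> F" "\<And>e. e \<in> F \<Longrightarrow> e \<subseteq> W"
    using pendant_ext_finite[OF P(1) _ subC] by auto
  have vsne: "vs \<noteq> []" using vs by auto
  have WV: "W = V"
  proof (rule ccontr)
    assume "W \<noteq> V"
    then obtain b where b: "b \<in> V" "b \<notin> W" using P(2) by blast
    have a: "hd vs \<in> W" using W(2) vsne by auto
    then have "(hd vs, b) \<in> (adj_rel E)\<^sup>*" using conn b P(2) by (auto simp: connected_graph_def)
    from rtrancl_leaves_set[OF this a b(2)]
    obtain x y where xy: "{x, y} \<in> E" "x \<in> W" "y \<notin> W" by (auto simp: adj_rel_def)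
    then have "y \<in> V" using E(1)[of "{x, y}"] by auto
    then have "P (insert y W, insert {y, x} F)"
      using P xy pendant_ext.step[OF P(1) xy(2,3)] by (simp add: P_def insert_commute)
    then show False using max[of "(insert y W, insert {y, x} F)"] WF W(1) xy(3) by simp
  qed
  have "F = E"
  proof (rule ccontr)
    assume "F \<noteq> E"
    then obtain e where e: "e \<in> E" "e \<notin> F" using P(3) by blast
    then obtain x y where xy: "e = {x, y}" "x \<noteq> y" using E(2)[OF e(1)] by (meson card_2_iff)
    have xW: "x \<in> W" "y \<in> W" using E(1)[OF e(1)] xy WV by auto
    have len: "length vs \<ge> 1" using vs(2) by simp
    \<comment> \<open>Pendant extensions of the connected cycle are connected, so the ends of e are
      joined by a path inside F.\<close>
    have "component (path_edges vs) (hd vs) = set vs" using vs vsne by (intro component_path)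
    moreover have "component ?C (hd vs) \<supseteq> component (path_edges vs) (hd vs)"
      unfolding cycle_edges_path[OF len] by (rule component_mono) auto
    moreover have "component ?C (hd vs) \<subseteq> set vs" using subC vsne by (intro component_subset) auto
    ultimately have "component ?C (hd vs) = set vs" by simp
    then have "component F (hd vs) = W"
      using vsne by (intro pendant_ext_component[OF P(1) _ subC]) auto
    then have "y \<in> component F x" using component_eq[of x F "hd vs"] xW by simp
    then obtain ps where ps: "ps \<noteq> []" "distinct ps" "hd ps = x" "last ps = y" "path_edges ps \<subseteq> F"
      using path_exists[of x y F] unfolding component_def by blast
    \<comment> \<open>A path with one vertex contradicts x \<noteq> y, and one with two vertices
      would be the edge e itself, which is not in F.\<close>
    have "length ps \<ge> 3"
    proof (rule ccontr)
      assume "\<not> length ps \<ge> 3"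
      moreover have "length ps \<noteq> 0" using ps(1) by simp
      ultimately have "length ps = 1 \<or> length ps = 2" by linarith
      then show False
      proof
        assume "length ps = 1"
        then show False using ps(3,4) xy(2) by (auto simp: length_Suc_conv)
      next
        assume "length ps = 2"
        then obtain a b where "ps = [a, b]" by (auto simp: length_Suc_conv numeral_2_eq_2)
        then show False using ps(3,4,5) e(2) xy(1) by simp
      qed
    qed
    then have len: "length ps \<ge> 3" "length ps \<ge> 1" by simp_all
    have C': "cycle_edges ps = insert {x, y} (path_edges ps)"
      using ps(3,4) by (simp add: cycle_edges_path[OF len(2)])
    then have "cycle_edges ps \<subseteq> E" using ps(5) P(3) e(1) xy(1) by auto
    then have "cycle_edges ps \<in> cycles E" using ps(2) len(1) unfolding cycles_def by blast
    then have "cycle_edges ps = ?C" by (rule uniq)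
    then show False using C' W(3) e(2) xy(1) by auto
  qed
  with P(1) WV show ?thesis by simp
qed

section \<open>The leading coefficient\<close>

text \<open>Every factor is 1 or \<epsilon>, so the product is \<epsilon> to the number of vertices
  satisfying P; these are its two coefficients.\<close>

lemma deriv_prod_indicator:
  assumes "finite B"
  shows "deriv_prod (\<lambda>v. of_bool (\<not> P v)) (\<lambda>v. of_bool (P v)) B =
    (of_bool (card {v \<in> B. P v} = 1) :: 'b::comm_ring_1)"
    and "(\<Prod>v\<in>B. of_bool (\<not> P v)) = (of_bool (card {v \<in> B. P v} = 0) :: 'b::comm_ring_1)"
proof -
  have 2: "(\<Prod>v\<in>B. of_bool (\<not> P v)) = (of_bool (card {v \<in> B. P v} = 0) :: 'b)"
    if "finite B" for B
    using that by (auto simp: prod_of_bool)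
  then show "(\<Prod>v\<in>B. of_bool (\<not> P v)) = (of_bool (card {v \<in> B. P v} = 0) :: 'b)"
    using assms .
  show "deriv_prod (\<lambda>v. of_bool (\<not> P v)) (\<lambda>v. of_bool (P v)) B =
    (of_bool (card {v \<in> B. P v} = 1) :: 'b)"
    using assms
  proof (induction B rule: finite_induct)
    case empty
    then show ?case by (simp add: deriv_prod_def)
  next
    case (insert u B)
    have "{v \<in> insert u B. P v} = (if P u then insert u {v \<in> B. P v} else {v \<in> B. P v})" by auto
    then show ?case using insert 2[of B] by (simp add: deriv_prod_insert)
  qed
qed

lemma components_nonempty: "B \<in> components V S \<Longrightarrow> B \<noteq> {}"
  unfolding components_def by (metis component_self empty_iff imageE)

lemma sum_components:
  assumes "finite V" "\<And>e. e \<in> S \<Longrightarrow> e \<subseteq> V"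
  shows "(\<Sum>B\<in>components V S. \<Sum>v\<in>B. g v) = (\<Sum>v\<in>V. g v)"
proof -
  have "\<forall>B\<in>components V S. finite B"
    using Union_components[OF assms(2)] assms(1) by (metis Union_upper finite_subset)
  moreover have "\<forall>A\<in>components V S. \<forall>B\<in>components V S. A \<noteq> B \<longrightarrow> A \<inter> B = {}"
    using components_disjoint by blast
  ultimately have "sum g (\<Union>(components V S)) = (\<Sum>B\<in>components V S. sum g B)"
    by (subst sum.Union_disjoint) (auto simp: o_def)
  then show ?thesis using Union_components[OF assms(2)] by simp
qed

lemma sum_mset_sum: "\<Sum>\<^sub># (\<Sum>v\<in>B. h v) = (\<Sum>v\<in>B. \<Sum>\<^sub># (h v :: nat multiset))"
  by (induction B rule: infinite_finite_induct) auto

lemma in_sum_singletons: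
  "finite B \<Longrightarrow> x \<in># (\<Sum>v\<in>B. {#g v#}) \<longleftrightarrow> x \<in> g ` B"
  by (induction B rule: finite_induct) auto

lemma sum_eq_replicate_mset:
  "finite B \<Longrightarrow> (\<And>v. v \<in> B \<Longrightarrow> g v = x) \<Longrightarrow> (\<Sum>v\<in>B. {#g v#}) = replicate_mset (card B) x"
  by (induction B rule: finite_induct) auto

text \<open>Compares the lead of the block, which puts all leaves into one part, with the
  distribution of the leaves over the vertices of B. They agree if at most one vertex has leaves;
  otherwise the distribution is strictly smaller and gets coefficient 0.\<close>

lemma star_lead_pendant_block:
  fixes l :: "'a \<Rightarrow> nat"
  assumes B: "finite B" "B \<noteq> {}" and L: "finite L" "B \<inter> L = {}" and card: "card L = (\<Sum>v\<in>B. l v)"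
  shows "star_lead (\<Sum>v\<in>B. Suc (l v)) (\<Sum>v\<in>B. {#Suc (l v)#})
     (of_bool (card {v \<in> B. l v > 0} \<le> 1)) (block_sf B L)"
proof -
  have n: "(\<Sum>v\<in>B. Suc (l v)) = card B + card L"
    by (simp add: card sum_Suc)
  define M where "M = add_mset (Suc (card L)) (replicate_mset (card B - 1) 1)"
  have lead: "star_lead (\<Sum>v\<in>B. Suc (l v)) M 1 (block_sf B L)"
    unfolding n M_def using B L by (intro star_lead_block)
  show ?thesis
  proof (cases "card {v \<in> B. l v > 0} \<le> 1")
    case True
    \<comment> \<open>The vertex with leaves, or any vertex of B if there is none.\<close>
    obtain w where w: "w \<in> B" "\<And>v. v \<in> B - {w} \<Longrightarrow> l v = 0"
    proof (cases "{v \<in> B. l v > 0} = {}")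
      case True
      moreover obtain w where "w \<in> B" using B(2) by blast
      ultimately show ?thesis by (intro that[of w]) auto
    next
      case False
      then have "card {v \<in> B. l v > 0} > 0" using B(1) by (simp only: card_gt_0_iff) simp
      then have "card {v \<in> B. l v > 0} = 1" using True by linarith
      then obtain w where eq: "{v \<in> B. l v > 0} = {w}" by (auto simp: card_1_singleton_iff)
      show ?thesis
      proof (rule that)
        show "w \<in> B" using eq by blast
        fix v assume v: "v \<in> B - {w}"
        then have "v \<notin> {v \<in> B. l v > 0}" unfolding eq by simp
        then show "l v = 0" using v by simp
      qed
    qed
    have ins: "B = insert w (B - {w})" using w by auto
    have "(\<Sum>v\<in>B. l v) = l w" using w B(1) by (subst ins) (simp add: sum.insert_remove)
    moreover have "(\<Sum>v\<in>B - {w}. {#Suc (l v)#}) = replicate_mset (card (B - {w})) 1"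
      using w B(1) by (intro sum_eq_replicate_mset) auto
    moreover have "(\<Sum>v\<in>B. {#Suc (l v)#}) = {#Suc (l w)#} + (\<Sum>v\<in>B - {w}. {#Suc (l v)#})"
      using w B(1) by (simp add: sum.remove)
    ultimately have "(\<Sum>v\<in>B. {#Suc (l v)#}) = M"
      using card w B(1) by (simp add: M_def)
    then show ?thesis using lead True by simp
  next
    case False
    have "(\<Sum>v\<in>B. {#Suc (l v)#}) < M"
    proof -
      \<comment> \<open>Some other vertex of B has leaves too, so no vertex owns all of L.\<close>
      have "l v < card L" if "v \<in> B" for v
      proof -
        have "\<not> {u \<in> B. l u > 0} \<subseteq> {v}"
          using False card_mono[of "{v}" "{u \<in> B. l u > 0}"] by auto
        then obtain u where u: "u \<in> B - {v}" "l u > 0" by blast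
        have "l u \<le> (\<Sum>v\<in>B - {v}. l v)" using u B(1) by (intro member_le_sum) auto
        moreover have "card L = l v + (\<Sum>v\<in>B - {v}. l v)" using card B(1) that by (simp add: sum.remove)
        ultimately show ?thesis using u by simp
      qed
      then have "\<forall>x. x \<in># (\<Sum>v\<in>B. {#Suc (l v)#}) \<longrightarrow> x < Suc (card L)"
        using B(1) by (auto simp: in_sum_singletons)
      moreover have "Suc (card L) \<in># M" by (simp add: M_def)
      ultimately show ?thesis by (meson ex_gt_imp_less_multiset)
    qed
    then show ?thesis using star_lead_weaken[OF lead] False by simp
  qed
qed

text \<open>Adding up the parts over the components gives the same multiset for every edge set, so
  all terms are compared at one index and only their coefficients depend on the edge set.\<close>

lemma star_lead_chromatic_sf:
  fixes I L :: "'a set" and F :: "'a set set" and \<eta> :: "'a \<Rightarrow> 'a"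
  assumes fin: "finite I" "finite L" and disj: "I \<inter> L = {}" and \<eta>: "\<And>v. v \<in> L \<Longrightarrow> \<eta> v \<in> I"
    and F: "\<And>e. e \<in> F \<Longrightarrow> e \<subseteq> I \<and> card e = 2"
  defines "l \<equiv> (\<lambda>v. card {u \<in> L. \<eta> u = v})"
  shows "star_lead (card (I \<union> L)) (\<Sum>v\<in>I. {#Suc (l v)#})
      (edge_expansion I F (block_weight (\<lambda>v. of_bool (\<not> l v > 0)) (\<lambda>v. of_bool (l v > 0))))
      (chromatic_sf (I \<union> L) (F \<union> {{v, \<eta> v} | v. v \<in> L}))"
    and "(\<Sum>v\<in>I. {#Suc (l v)#}) \<in> part_msets (card (I \<union> L))"
proof -
  let ?w = "block_weight (\<lambda>v. of_bool (\<not> l v > 0)) (\<lambda>v. of_bool (l v > 0)) :: 'a set \<Rightarrow> rat"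
  let ?L = "\<lambda>B. {v \<in> L. \<eta> v \<in> B}"
  have cardL: "card (?L B) = (\<Sum>v\<in>B. l v)" if "B \<subseteq> I" for B
  proof -
    have "?L B = (\<Union>v\<in>B. {u \<in> L. \<eta> u = v})" by auto
    also have "card \<dots> = (\<Sum>v\<in>B. card {u \<in> L. \<eta> u = v})"
      using that fin by (intro card_UN_disjoint) (auto intro: finite_subset)
    finally show ?thesis by (simp add: l_def)
  qed
  have "?L I = L" using \<eta> by auto
  then have cardV: "card (I \<union> L) = (\<Sum>v\<in>I. Suc (l v))"
    using cardL[of I] fin disj by (simp add: card_Un_disjoint sum_Suc)
  show "(\<Sum>v\<in>I. {#Suc (l v)#}) \<in> part_msets (card (I \<union> L))"
    using fin(1) by (auto simp: part_msets_def cardV sum_mset_sum in_sum_singletons)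
  have w: "?w B = of_bool (card {v \<in> B. l v > 0} \<le> 1)" if "finite B" for B
    unfolding block_weight_def deriv_prod_indicator[OF that] by (auto simp: le_Suc_eq)
  have "star_lead (\<Sum>v\<in>I. Suc (l v)) (\<Sum>v\<in>I. {#Suc (l v)#})
      (edge_expansion I F ?w) (edge_expansion I F (\<lambda>B. block_sf B (?L B)))"
    unfolding edge_expansion_def
  proof (intro star_lead_sum star_lead_sign)
    fix S assume "S \<in> Pow F"
    then have SI: "\<And>e. e \<in> S \<Longrightarrow> e \<subseteq> I" using F by blast
    have B: "B \<subseteq> I" "B \<noteq> {}" if "B \<in> components I S" for B
      using that Union_components[OF SI] components_nonempty by blast+
    have "star_lead (\<Sum>B\<in>components I S. \<Sum>v\<in>B. Suc (l v)) (\<Sum>B\<in>components I S. \<Sum>v\<in>B. {#Suc (l v)#})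
       (\<Prod>B\<in>components I S. ?w B) (\<Prod>B\<in>components I S. block_sf B (?L B))"
    proof (rule star_lead_prod[THEN conjunct1])
      fix B assume BS: "B \<in> components I S"
      have finB: "finite B" using B(1)[OF BS] fin(1) by (rule finite_subset)
      show "star_lead (\<Sum>v\<in>B. Suc (l v)) (\<Sum>v\<in>B. {#Suc (l v)#}) (?w B) (block_sf B (?L B))"
        unfolding w[OF finB] using finB B[OF BS] fin disj
        by (intro star_lead_pendant_block cardL) auto
      show "(\<Sum>v\<in>B. {#Suc (l v)#}) \<in> part_msets (\<Sum>v\<in>B. Suc (l v))"
        using finB by (auto simp: part_msets_def sum_mset_sum in_sum_singletons)
    qed
    then show "star_lead (\<Sum>v\<in>I. Suc (l v)) (\<Sum>v\<in>I. {#Suc (l v)#})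
       (\<Prod>B\<in>components I S. ?w B) (\<Prod>B\<in>components I S. block_sf B (?L B))"
      by (simp only: sum_components[OF fin(1) SI])
  qed
  then show "star_lead (card (I \<union> L)) (\<Sum>v\<in>I. {#Suc (l v)#}) (edge_expansion I F ?w)
      (chromatic_sf (I \<union> L) (F \<union> {{v, \<eta> v} | v. v \<in> L}))"
    by (simp only: cardV chromatic_sf_expansion[where \<eta> = \<eta>, OF fin disj \<eta> F])
qed

text \<open>A walk starting at an internal vertex that enters a leaf can only turn back, so it
  reaches every internal vertex through internal ones and meets a leaf only next to an internal
  vertex. The vertex w excludes the graph with a single edge, whose leaves are adjacent to each
  other.\<close>

lemma leaf_structure:
  fixes V :: "'a set" and E :: "'a set set"
  assumes G: "simple_graph V E" and conn: "connected_graph V E" and w: "w \<in> internal_vertices V E"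
  defines "I \<equiv> internal_vertices V E"
  defines "F \<equiv> {e \<in> E. e \<subseteq> I}"
  shows "V = I \<union> leaves V E" "component F w = I"
    "\<And>v. v \<in> leaves V E \<Longrightarrow> \<exists>v'\<in>I. {e \<in> E. v \<in> e} = {{v, v'}}"
proof -
  have E: "e \<subseteq> V" "card e = 2" if "e \<in> E" for e using G that by (auto simp: simple_graph_def)
  have fin: "finite V" using G by (simp add: simple_graph_def)
  have finE: "finite E" using fin E by (intro finite_subset[of E "Pow V"]) auto
  have IV: "I \<subseteq> V" by (auto simp: I_def internal_vertices_def)
  have key: "v \<in> I \<and> v \<in> component F w \<or>
      v \<notin> I \<and> (\<exists>v'\<in>I. v' \<in> component F w \<and> {e \<in> E. v \<in> e} = {{v, v'}})"
    if "(w, v) \<in> (adj_rel E)\<^sup>*" for v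
    using that
  proof (induction rule: rtrancl_induct)
    case base
    then show ?case using w by (simp add: I_def)
  next
    case (step b c)
    have bc: "{b, c} \<in> E" using step.hyps(2) by (simp add: adj_rel_def)
    have bcne: "b \<noteq> c" using E(2)[OF bc] by auto
    have cV: "c \<in> V" using E(1)[OF bc] by simp
    from step.IH show ?case
    proof
      assume b: "b \<in> I \<and> b \<in> component F w"
      show ?thesis
      proof (cases "c \<in> I")
        case True
        then have "c \<in> component F b" using b bc by (auto simp: component_def F_def adj_rel_def)
        then show ?thesis using True b component_trans[of b F w c] by blast
      next
        case False
        \<comment> \<open>A vertex of degree below 2 has no edge besides the one just used.\<close>
        have "card {e \<in> E. c \<in> e} \<le> 1"
          using False cV by (simp add: I_def internal_vertices_def vdegree_def)
        moreover have "{{b, c}} \<subseteq> {e \<in> E. c \<in> e}" using bc by simp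
        ultimately have "{{b, c}} = {e \<in> E. c \<in> e}"
          using finE by (intro card_seteq) auto
        then show ?thesis using False b by (metis insert_commute)
      qed
    next
      assume "b \<notin> I \<and> (\<exists>v'\<in>I. v' \<in> component F w \<and> {e \<in> E. b \<in> e} = {{b, v'}})"
      then obtain v' where v': "v' \<in> I" "v' \<in> component F w" "{e \<in> E. b \<in> e} = {{b, v'}}" by blast
      have "{b, c} \<in> {e \<in> E. b \<in> e}" using bc by simp
      then have "c = v'" unfolding v'(3) using bcne by (auto simp: doubleton_eq_iff)
      then show ?thesis using v' by blast
    qed
  qed
  have reach: "(w, v) \<in> (adj_rel E)\<^sup>*" if "v \<in> V" for v
    using conn w that by (simp add: connected_graph_def internal_vertices_def)
  have leaf: "v \<in> leaves V E" if v: "v \<in> V" "v \<notin> I" for v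
  proof -
    obtain v' where "{e \<in> E. v \<in> e} = {{v, v'}}" using key[OF reach[OF v(1)]] v(2) by blast
    then show ?thesis using v(1) by (simp add: leaves_def vdegree_def)
  qed
  then show "V = I \<union> leaves V E" using IV by (auto simp: leaves_def)
  have notI: "v \<notin> I" if "v \<in> leaves V E" for v
    using that by (auto simp: leaves_def I_def internal_vertices_def)
  show "component F w = I"
  proof
    show "component F w \<subseteq> I" using w by (intro component_subset) (auto simp: F_def I_def)
    show "I \<subseteq> component F w" using key reach IV by blast
  qed
  show "\<exists>v'\<in>I. {e \<in> E. v \<in> e} = {{v, v'}}" if "v \<in> leaves V E" for v
    using key[OF reach] notI[OF that] that by (auto simp: leaves_def)
qed

lemma prod_if_neg:
  fixes g :: "'a \<Rightarrow> 'b::comm_ring_1"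
  assumes "finite X"
  shows "(\<Prod>v\<in>X. if P v then 1 else - g v) = (-1) ^ card {v \<in> X. \<not> P v} * (\<Prod>v | v \<in> X \<and> \<not> P v. g v)"
proof -
  have "(\<Prod>v\<in>X. if P v then 1 else - g v) = (\<Prod>v | v \<in> X \<and> \<not> P v. - g v)"
    using assms by (subst prod.If_cases) (auto intro!: prod.cong)
  then show ?thesis by (simp add: prod_uminus)
qed

text \<open>Multiplying out leaves positive mixed terms. With y = d - 2 this is the positivity of
  the bracket in the case r = s.\<close>

lemma prod_gt_one_plus_sum:
  fixes y :: "'a \<Rightarrow> rat"
  assumes "finite S" "card S \<ge> 2" "\<And>v. v \<in> S \<Longrightarrow> y v \<ge> 1"
  shows "(\<Prod>v\<in>S. 1 + y v) > 1 + (\<Sum>v\<in>S. y v)"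
proof -
  have weak: "(\<Prod>v\<in>S. 1 + y v) \<ge> 1 + (\<Sum>v\<in>S. y v)" if "finite S" "\<And>v. v \<in> S \<Longrightarrow> y v \<ge> 1" for S
    using that
  proof (induction S rule: finite_induct)
    case (insert v S)
    then have "(1 + y v) * (\<Prod>v\<in>S. 1 + y v) \<ge> (1 + y v) * (1 + (\<Sum>v\<in>S. y v))"
      by (intro mult_left_mono) (auto simp: order_trans[OF zero_le_one])
    moreover have "y v * (\<Sum>v\<in>S. y v) \<ge> 0"
      using insert.prems by (intro mult_nonneg_nonneg sum_nonneg) (auto intro: order_trans[OF zero_le_one])
    ultimately show ?case using insert.hyps by (simp add: algebra_simps)
  qed simp
  obtain v where v: "v \<in> S" using assms(2) by fastforce
  let ?T = "S - {v}"
  have T: "finite ?T" "card ?T \<ge> 1" using assms(1,2) v by auto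
  then obtain u where u: "u \<in> ?T" by (metis card.empty ex_in_conv not_one_le_zero)
  have "1 \<le> y u" using u assms(3) by blast
  also have "y u \<le> (\<Sum>v\<in>?T. y v)"
    using u T(1) assms(3) by (intro member_le_sum) (auto intro: order_trans[OF zero_le_one])
  finally have pos: "(\<Sum>v\<in>?T. y v) > 0" by simp
  have yv: "y v \<ge> 1" using v assms(3) by blast
  have "(1 + y v) * (1 + (\<Sum>v\<in>?T. y v)) \<le> (1 + y v) * (\<Prod>v\<in>?T. 1 + y v)"
    using weak[OF T(1)] assms(3) yv by (intro mult_left_mono) auto
  moreover have "y v * (\<Sum>v\<in>?T. y v) > 0" using yv pos by simp
  ultimately show ?thesis
    using v assms(1) by (simp add: prod.remove sum.remove algebra_simps)
qed

theorem theorem6p7: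
  fixes V :: "'a set" and E C :: "'a set set" and S D :: "'a set" and c r s p :: nat
  assumes "simple_graph V E" and "connected_graph V E" and "unicyclic E"
    and "C \<in> cycles E" and "card C = c" and "c \<ge> 3"
    and "r = card (nontrivial_roots V E C)" and "r \<ge> 2"
    and "S = sprouts V E C" and "s = card S"
    and "D = deep_vertices V E - S" and "p = card D"
  shows "leading_coeff V E = (-1) ^ (p + s) *
    (if r = s then
       (\<Prod>v\<in>D. (of_nat (vdegree E v) - 1)) *
         ((\<Prod>v\<in>S. (of_nat (vdegree E v) - 1)) - (\<Sum>v\<in>S. of_nat (vdegree E v)) + 2 * of_nat s - 1)
     else if r = s + 1 then
       (\<Prod>v\<in>D. (of_nat (vdegree E v) - 1)) * ((\<Prod>v\<in>S. (of_nat (vdegree E v) - 1)) - 1)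
     else
       (\<Prod>v\<in>D. (of_nat (vdegree E v) - 1)) * (\<Prod>v\<in>S. (of_nat (vdegree E v) - 1)))"
    (is "_ = ?rhs")
proof -
  note G = assms(1) and conn = assms(2)
  define I where "I = internal_vertices V E"
  define L where "L = leaves V E"
  define F where "F = {e \<in> E. e \<subseteq> I}"
  let ?d = "\<lambda>v. of_nat (vdegree E v) :: rat"
  have E: "e \<subseteq> V" "card e = 2" if "e \<in> E" for e using G that by (auto simp: simple_graph_def)
  have finV: "finite V" using G by (simp add: simple_graph_def)
  have finE: "finite E" using finV E by (intro finite_subset[of E "Pow V"]) auto
  have finI: "finite I" "finite L" "I \<subseteq> V" "L \<subseteq> V"
    using finV by (auto simp: I_def L_def internal_vertices_def leaves_def)
  have disj: "I \<inter> L = {}" by (auto simp: I_def L_def internal_vertices_def leaves_def)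

  \<comment> \<open>The cycle, the leaves and the candidate partition\<close>
  obtain vs where vs: "C = cycle_edges vs" "length vs \<ge> 3" "distinct vs" "C \<subseteq> E"
    using assms(4) by (auto simp: cycles_def)
  have UC: "\<Union>C = set vs" using vs Union_cycle_edges by simp
  have uniq: "C' = cycle_edges vs" if "C' \<in> cycles E" for C'
    using assms(3,4) that vs(1) by (auto simp: unicyclic_def)
  have c: "length vs = c" using assms(5) vs card_cycle_edges by metis
  have degC: "card {e \<in> C. v \<in> e} = 2" if "v \<in> set vs" for v
    using vdegree_cycle[OF vs(3,2) that] by (simp add: vdegree_def vs(1))
  have degC_le: "card {e \<in> C. v \<in> e} \<le> vdegree E v" for v
    unfolding vdegree_def using vs(4) finE by (intro card_mono) auto
  have CI: "set vs \<subseteq> I"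
  proof
    fix v assume v: "v \<in> set vs"
    then have "v \<in> V" using UC vs(4) E(1) by blast
    then show "v \<in> I" using degC[OF v] degC_le[of v] by (simp add: I_def internal_vertices_def)
  qed
  have "hd vs \<in> I" using CI vs(2) by (cases vs) auto
  note struct = leaf_structure[OF G conn this[unfolded I_def], folded I_def, folded F_def L_def]
  have VIL: "V = I \<union> L" and compF: "component F (hd vs) = I" by (rule struct(1,2))+
  have "\<forall>v\<in>L. \<exists>v'. v' \<in> I \<and> {e \<in> E. v \<in> e} = {{v, v'}}" using struct(3) by blast
  then obtain \<eta> where \<eta>: "\<And>v. v \<in> L \<Longrightarrow> \<eta> v \<in> I" "\<And>v. v \<in> L \<Longrightarrow> {e \<in> E. v \<in> e} = {{v, \<eta> v}}"
    by metis
  have \<eta>E: "{v, u} \<in> E \<longleftrightarrow> u = \<eta> v" if "v \<in> L" for u v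
  proof -
    have "{v, u} \<in> E \<longleftrightarrow> {v, u} \<in> {e \<in> E. v \<in> e}" by simp
    also have "\<dots> \<longleftrightarrow> u = \<eta> v" unfolding \<eta>(2)[OF that] by (auto simp: doubleton_eq_iff)
    finally show ?thesis .
  qed
  have EF: "E = F \<union> {{v, \<eta> v} | v. v \<in> L}"
  proof (intro equalityI subsetI)
    fix e assume e: "e \<in> E"
    show "e \<in> F \<union> {{v, \<eta> v} | v. v \<in> L}"
    proof (cases "e \<subseteq> I")
      case False
      then obtain v where "v \<in> e" "v \<in> L" using E(1)[OF e] VIL by blast
      then have "e \<in> {{v, \<eta> v}}" using e \<eta>(2)[of v] by blast
      then show ?thesis using \<open>v \<in> L\<close> by blast
    qed (use e in \<open>simp add: F_def\<close>)
  qed (use \<eta>E in \<open>auto simp: F_def\<close>)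
  define l where "l = (\<lambda>v. card {u \<in> L. \<eta> u = v})"
  have Fe: "e \<subseteq> I \<and> card e = 2" if "e \<in> F" for e using that E by (auto simp: F_def)
  let ?f = "\<lambda>v. of_bool (\<not> l v > 0) :: rat" and ?m = "\<lambda>v. of_bool (l v > 0) :: rat"
  define A where "A = edge_expansion I F (block_weight ?f ?m)"
  have "star_lead (card (I \<union> L)) (\<Sum>v\<in>I. {#Suc (l v)#}) A (chromatic_sf (I \<union> L) (F \<union> {{v, \<eta> v} | v. v \<in> L}))"
    "(\<Sum>v\<in>I. {#Suc (l v)#}) \<in> part_msets (card (I \<union> L))"
    unfolding A_def l_def
    by (rule star_lead_chromatic_sf; use finI disj \<eta>(1) Fe in blast)+
  then have lead: "star_lead (card V) (\<Sum>v\<in>I. {#Suc (l v)#}) A (chromatic_sf V E)"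
    "(\<Sum>v\<in>I. {#Suc (l v)#}) \<in> part_msets (card V)"
    unfolding EF[symmetric] VIL[symmetric] .

  \<comment> \<open>Deep vertices and their degrees among the internal vertices\<close>
  have deep: "deep_vertices V E = {v \<in> I. l v = 0}"
  proof -
    have "(\<forall>u\<in>L. {u, v} \<notin> E) \<longleftrightarrow> l v = 0" for v
      using \<eta>E finI(2) by (auto simp: l_def)
    then show ?thesis by (auto simp: deep_vertices_def I_def L_def)
  qed
  \<comment> \<open>Vertices without leaves lose no edge in the passage from E to F. Their degrees
    are the ones that count, as \<open>?f\<close> vanishes at the others.\<close>
  have degF: "vdegree F v = vdegree E v" if "v \<in> I" "l v = 0" for v
  proof -
    have "v \<notin> e" if e: "e \<in> E - F" for e
    proof -
      obtain u where "u \<in> L" "e = {u, \<eta> u}" using e EF by blast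
      then show ?thesis using \<open>v \<in> I\<close> \<open>l v = 0\<close> disj finI(2) by (auto simp: l_def)
    qed
    then have "{e \<in> F. v \<in> e} = {e \<in> E. v \<in> e}" by (auto simp: F_def)
    then show ?thesis by (simp add: vdegree_def)
  qed
  have degI: "vdegree E v \<ge> 2" if "v \<in> I" for v using that by (simp add: I_def internal_vertices_def)

  \<comment> \<open>Evaluation of the weighted expansion\<close>
  have CF: "C \<subseteq> F" using vs(4) CI UC by (auto simp: F_def)
  have "pendant_ext (set vs) (cycle_edges vs) I F"
  proof (rule unicyclic_pendant_ext)
    show "simple_graph I F" using finI(1) Fe by (simp add: simple_graph_def)
    show "connected_graph I F"
      unfolding connected_graph_def
    proof (intro conjI ballI)
      show "I \<noteq> {}" using \<open>hd vs \<in> I\<close> by blast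
      fix u v assume "u \<in> I" "v \<in> I"
      then have "v \<in> component F u" using component_eq[of u F "hd vs"] compF by simp
      then show "(u, v) \<in> (adj_rel F)\<^sup>*" by (simp add: component_def)
    qed
    show "cycle_edges vs \<subseteq> F" using CF vs(1) by simp
    show "C' = cycle_edges vs" if "C' \<in> cycles F" for C'
      using that by (intro uniq) (auto simp: cycles_def F_def)
  qed (use vs in auto)
  from edge_expansion_unicyclic[OF vs(3,2) this, of ?f ?m, folded A_def]
  have A: "A = (\<Prod>v\<in>I - set vs. ?m v - (of_nat (vdegree F v) - 1) * ?f v) *
    ((\<Prod>v\<in>set vs. ?m v - (of_nat (vdegree F v) - 1) * ?f v) +
     (-1) ^ c * (deriv_prod ?f (\<lambda>v. ?m v - (of_nat (vdegree F v) - 2) * ?f v) (set vs) - prod ?f (set vs)))"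
    unfolding c .
  define U where "U = {v \<in> I. l v = 0}"
  define K where "K = {v \<in> set vs. l v > 0}"
  \<comment> \<open>With leaves at v, \<open>?f v\<close> is 0 and the factor is 1; without,
    \<open>?m v\<close> is 0 and the factor is 1 - d.\<close>
  have z: "?m v - (of_nat (vdegree F v) - 1) * ?f v = (if l v > 0 then 1 else - (?d v - 1))" if "v \<in> I" for v
    using degF[OF that] by simp
  have Zset: "(\<Prod>v\<in>X. ?m v - (of_nat (vdegree F v) - 1) * ?f v) =
      (-1) ^ card (U \<inter> X) * (\<Prod>v\<in>U \<inter> X. ?d v - 1)" if "X \<subseteq> I" for X
  proof -
    have "(\<Prod>v\<in>X. ?m v - (of_nat (vdegree F v) - 1) * ?f v) = (\<Prod>v\<in>X. if l v > 0 then 1 else - (?d v - 1))"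
      using that by (intro prod.cong refl z) auto
    also have "\<dots> = (-1) ^ card {v \<in> X. \<not> l v > 0} * (\<Prod>v | v \<in> X \<and> \<not> l v > 0. ?d v - 1)"
      using that finI(1) finite_subset by (intro prod_if_neg) blast
    also have "{v \<in> X. \<not> l v > 0} = U \<inter> X" using that by (auto simp: U_def)
    finally show ?thesis .
  qed
  have finU: "finite U" using finI(1) by (simp add: U_def)
  have S: "S = {v \<in> U \<inter> set vs. vdegree E v \<ge> 3}"
    by (auto simp: assms(9) sprouts_def deep U_def UC)
  have D: "D = U - S" by (simp add: assms(11) deep U_def)
  have finS: "finite S" using finU by (simp add: S)
  have two: "vdegree E v = 2" if "v \<in> U \<inter> set vs - S" for v
    using that degI[of v] by (auto simp: S U_def)
  have PS: "(\<Prod>v\<in>U \<inter> set vs. ?d v - 1) = (\<Prod>v\<in>S. ?d v - 1)"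
    using finU two by (intro prod.mono_neutral_right) (auto simp: S)
  have U_diff: "U \<inter> (I - set vs) = U - set vs" by (auto simp: U_def)
  have PD: "(\<Prod>v\<in>U - set vs. ?d v - 1) = (\<Prod>v\<in>D. ?d v - 1)"
    using finU two by (intro prod.mono_neutral_left) (auto simp: S D)
  \<comment> \<open>The sign, in contrast, counts the deep cycle vertices of degree two; they are
    counted by p.\<close>
  have ps: "card (U - set vs) + card (U \<inter> set vs) = p + s"
  proof -
    have "p + s = card U" using finU finS by (auto simp: assms(10,12) D S card_Diff_subset card_mono)
    moreover have "card (U - set vs) + card (U \<inter> set vs) = card U"
      using card_Int_Diff[OF finU, of "set vs"] by simp
    ultimately show ?thesis by simp
  qed
  have cK: "c = card (U \<inter> set vs) + card K"
  proof -
    have "set vs = (U \<inter> set vs) \<union> K" using CI by (auto simp: U_def K_def)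
    then have "card (set vs) = card ((U \<inter> set vs) \<union> K)" by (rule arg_cong)
    also have "\<dots> = card (U \<inter> set vs) + card K"
      by (intro card_Un_disjoint) (auto simp: U_def K_def)
    finally have "card (set vs) = card (U \<inter> set vs) + card K" .
    then show ?thesis using distinct_card[OF vs(3)] c by simp
  qed
  have Pf: "prod ?f (set vs) = of_bool (card K = 0)"
    unfolding K_def by (rule deriv_prod_indicator) simp
  have dF2: "?m v - (of_nat (vdegree F v) - 2) * ?f v = ?m v - (?d v - 2) * ?f v" if "v \<in> set vs" for v
    using degF[of v] CI that by auto
  \<comment> \<open>If no cycle vertex has leaves, all \<open>?f\<close> are 1 and the derivative is
    the sum of the shifted values. Otherwise a vertex without leaves has a zero among its cofactors,
    so only vertices with leaves, which are not shifted, can contribute.\<close>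
  have dP: "deriv_prod ?f (\<lambda>v. ?m v - (of_nat (vdegree F v) - 2) * ?f v) (set vs) =
      (if card K = 0 then - (\<Sum>v\<in>S. ?d v - 2) else of_bool (card K = 1))"
  proof (cases "card K = 0")
    case True
    then have K0: "l v = 0" if "v \<in> set vs" for v using that by (auto simp: K_def)
    have "deriv_prod ?f (\<lambda>v. ?m v - (of_nat (vdegree F v) - 2) * ?f v) (set vs) =
        (\<Sum>v\<in>set vs. - (?d v - 2))"
      unfolding deriv_prod_def
    proof (intro sum.cong refl)
      fix v assume v: "v \<in> set vs"
      have "(\<Prod>u\<in>set vs - {v}. ?f u) = 1" using K0 by (intro prod.neutral) auto
      then show "(?m v - (of_nat (vdegree F v) - 2) * ?f v) * (\<Prod>u\<in>set vs - {v}. ?f u) = - (?d v - 2)"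
        using dF2[OF v] K0[OF v] by simp
    qed
    also have "\<dots> = - (\<Sum>v\<in>set vs. ?d v - 2)" by (simp only: sum_negf)
    also have "(\<Sum>v\<in>set vs. ?d v - 2) = (\<Sum>v\<in>S. ?d v - 2)"
    proof (rule sum.mono_neutral_right)
      show "\<forall>v\<in>set vs - S. ?d v - 2 = 0"
      proof
        fix v assume "v \<in> set vs - S"
        then have "v \<in> U \<inter> set vs - S" using K0 CI by (auto simp: U_def)
        then show "?d v - 2 = 0" using two by simp
      qed
    qed (auto simp: S)
    finally show ?thesis using True by simp
  next
    case False
    have "deriv_prod ?f (\<lambda>v. ?m v - (of_nat (vdegree F v) - 2) * ?f v) (set vs) = deriv_prod ?f ?m (set vs)"
      unfolding deriv_prod_def
    proof (intro sum.cong refl)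
      fix v assume "v \<in> set vs"
      show "(?m v - (of_nat (vdegree F v) - 2) * ?f v) * (\<Prod>u\<in>set vs - {v}. ?f u) =
          ?m v * (\<Prod>u\<in>set vs - {v}. ?f u)"
      proof (cases "l v > 0")
        case False
        obtain u where "u \<in> K" using \<open>card K \<noteq> 0\<close> by fastforce
        then have "u \<in> set vs - {v}" "?f u = 0" using False by (auto simp: K_def)
        then have "(\<Prod>u\<in>set vs - {v}. ?f u) = 0" by (intro prod_zero) auto
        then show ?thesis by (simp only: mult_zero_right)
      qed simp
    qed
    also have "\<dots> = of_bool (card K = 1)" unfolding K_def by (rule deriv_prod_indicator) simp
    finally show ?thesis using False by simp
  qed
  let ?Q = "(\<Prod>v\<in>D. ?d v - 1)" and ?R = "(\<Prod>v\<in>S. ?d v - 1)"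
  have A': "A = (-1) ^ card (U - set vs) * ?Q *
     ((-1) ^ card (U \<inter> set vs) * ?R + (-1) ^ c *
       ((if card K = 0 then - (\<Sum>v\<in>S. ?d v - 2) else of_bool (card K = 1)) - of_bool (card K = 0)))"
    unfolding A Zset[OF Diff_subset] Zset[OF CI] U_diff PD PS dP Pf ..
  have sumS: "(\<Sum>v\<in>S. ?d v - 2) = (\<Sum>v\<in>S. ?d v) - 2 * of_nat s"
    by (simp add: sum_subtractf assms(10))

  \<comment> \<open>Non-trivial trees, sprouts and cycle vertices with leaves\<close>
  have tree: "attached_tree V E C v = component (E - C) v \<inter> V" for v
    by (auto simp: attached_tree_def component_def)
  have nontriv: "card (attached_tree V E C v) > 1 \<longleftrightarrow> vdegree E v \<ge> 3" if v: "v \<in> set vs" for v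
  proof
    assume *: "card (attached_tree V E C v) > 1"
    show "vdegree E v \<ge> 3"
    proof (rule ccontr)
      assume "\<not> vdegree E v \<ge> 3"
      then have "{e \<in> C. v \<in> e} = {e \<in> E. v \<in> e}"
        using degC[OF v] vs(4) finE by (intro card_seteq) (auto simp: vdegree_def)
      then have "component (E - C) v = {v}" by (intro component_isolated) blast
      then have "card (attached_tree V E C v) \<le> 1"
        using card_mono[of "{v}" "attached_tree V E C v"] by (simp add: tree)
      with * show False by simp
    qed
  next
    assume "vdegree E v \<ge> 3"
    then have "card {e \<in> E. v \<in> e} \<noteq> card {e \<in> C. v \<in> e}"
      unfolding degC[OF v] vdegree_def by simp
    then have "{e \<in> C. v \<in> e} \<noteq> {e \<in> E. v \<in> e}" by metis
    then obtain e where e: "e \<in> E - C" "v \<in> e" using vs(4) by blast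
    then have "card e = 2" using E(2) by blast
    then obtain x y where "e = {x, y}" "x \<noteq> y" by (meson card_2_iff)
    then obtain u where u: "e = {v, u}" "u \<noteq> v" using e(2) by blast
    then have "u \<in> component (E - C) v" using e(1) by (auto simp: component_def adj_rel_def)
    then have "{v, u} \<subseteq> attached_tree V E C v" using E(1)[of e] e u by (auto simp: tree)
    then have "card {v, u} \<le> card (attached_tree V E C v)" using finV by (intro card_mono) (auto simp: tree)
    then show "card (attached_tree V E C v) > 1" using u(2) by simp
  qed
  \<comment> \<open>An edge to a leaf is a third edge at v, since all cycle vertices are
    internal.\<close>
  have Kdeg: "vdegree E v \<ge> 3" if "v \<in> K" for v
  proof (rule ccontr)
    have v: "v \<in> set vs" "l v > 0" using that by (auto simp: K_def)
    assume "\<not> vdegree E v \<ge> 3"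
    then have *: "{e \<in> C. v \<in> e} = {e \<in> E. v \<in> e}"
      using degC[OF v(1)] vs(4) finE by (intro card_seteq) (auto simp: vdegree_def)
    have "{u \<in> L. \<eta> u = v} \<noteq> {}" using v(2) unfolding l_def card_gt_0_iff by blast
    then obtain u where u: "u \<in> L" "\<eta> u = v" by blast
    then have "{u, v} \<in> E" using \<eta>E by blast
    then have "{u, v} \<in> C" using * by blast
    then have "u \<in> I" using CI UC by blast
    with u(1) disj show False by blast
  qed
  \<comment> \<open>The root of a non-trivial tree either has a leaf or is deep of degree at least
    three, that is, a sprout.\<close>
  have "nontrivial_roots V E C = S \<union> K"
    using nontriv Kdeg CI by (auto simp: nontrivial_roots_def UC S K_def U_def)
  moreover have "S \<inter> K = {}" by (auto simp: S K_def U_def)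
  moreover have "finite K" by (simp add: K_def)
  ultimately have r: "r = s + card K" using finS by (simp add: assms(7,10) card_Un_disjoint)

  \<comment> \<open>Comparison with the three cases and nonvanishing\<close>
  have sgn: "(-1 :: rat) ^ c = (-1) ^ card (U \<inter> set vs) * (-1) ^ card K" by (simp add: cK power_add)
  \<comment> \<open>After (-1)^(p + s) is taken out, the cycle term keeps the sign (-1)^(r - s). Its
    value is minus the sum of d - 2 over S, minus 1, for r = s; it is 1 for r = s + 1, where the
    sign turns it into -1; it is 0 beyond.\<close>
  have Aeq: "A = ?rhs"
    unfolding A' ps[symmetric] power_add sgn sumS r by (auto simp: algebra_simps)
  have Q0: "?Q \<noteq> 0"
  proof -
    have "?d v - 1 \<noteq> 0" if "v \<in> D" for v using degI[of v] that by (auto simp: D U_def)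
    then show ?thesis using finU by (simp add: D)
  qed
  have d3: "?d v \<ge> 3" if "v \<in> S" for v
  proof -
    have "vdegree E v \<ge> 3" using that by (simp add: S)
    then show ?thesis by (metis of_nat_le_iff of_nat_numeral)
  qed
  have "A \<noteq> 0"
  proof -
    consider "card K = 0" | "card K = 1" | "card K \<ge> 2" by linarith
    then show ?thesis
    proof cases
      case 1
      \<comment> \<open>Here S has r elements, and the strict inequality needs two of them.\<close>
      then have "card S \<ge> 2" using r assms(8,10) by simp
      then have "(\<Prod>v\<in>S. 1 + (?d v - 2)) > 1 + (\<Sum>v\<in>S. ?d v - 2)"
        using finS d3 by (intro prod_gt_one_plus_sum) fastforce+
      moreover have "(\<Prod>v\<in>S. 1 + (?d v - 2)) = ?R" by (intro prod.cong) auto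
      ultimately have "?R - (\<Sum>v\<in>S. ?d v) + 2 * of_nat s - 1 \<noteq> 0" using sumS by simp
      then show ?thesis using Aeq 1 r Q0 by simp
    next
      case 2
      \<comment> \<open>One sprout suffices, since its factor is at least 2 and the product then
        exceeds 1.\<close>
      then have "S \<noteq> {}" using r assms(8,10) by auto
      then obtain v where v: "v \<in> S" by blast
      have "1 \<le> (\<Prod>v\<in>S - {v}. ?d v - 1)" using d3 by (intro prod_ge_1) fastforce
      moreover have "2 \<le> ?d v - 1" using d3[OF v] by simp
      ultimately have "2 * 1 \<le> (?d v - 1) * (\<Prod>v\<in>S - {v}. ?d v - 1)" by (intro mult_mono) auto
      then have "?R - 1 \<noteq> 0" using v finS by (simp add: prod.remove)
      then show ?thesis using Aeq 2 r Q0 by simp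
    next
      case 3
      have "?R \<noteq> 0" using d3 finS by fastforce
      then show ?thesis using Aeq 3 r Q0 by simp
    qed
  qed
  then have "leading_coeff V E = A" using lead by (intro leading_coeff_eqI)
  then show ?thesis using Aeq by simp
qed

end
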